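(* For every integer $w\ge 1$ there is a constant $b\in\mathbb{N}$ such that every finite poset of cliquewidth at most $w$ has Boolean dimension at most $b$.
   Context: All posets are finite. The Boolean dimension of a poset $(X,\le)$ is the least $b\in\mathbb{N}$ (with $b=0$ allowed) such that there exist $b$ linear orders $\preceq_1,\dots,\preceq_b$ on $X$ (not necessarily linear extensions of $\le$) and a function $\mathsf{decode}\colon\{0,1\}^b\to\{0,1\}$ such that for all distinct $x,y\in X$: $x\le y$ if and only if $\mathsf{decode}([x\preceq_1 y],\dots,[x\preceq_b y])=1$. Here $[\psi]$ is $1$ if the assertion $\psi$ holds and $0$ otherwise. The cliquewidth of a poset $(X,\le)$ is the cliquewidth of the directed graph on $X$ with an arc $(x,y)$ whenever $x<y$. The cliquewidth of a (loopless) directed graph is the least number $w$ of labels such that the graph can be constructed, as a vertex-labelled directed graph with labels in $\{1,\dots,w\}$, using the operations: create a single vertex with label $i$; take the disjoint union of two labelled directed graphs; for $i\neq j$, add all arcs from vertices labelled $i$ to vertices labelled $j$; change all labels $i$ to $j$. *)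

theory Defs
  imports Main
begin
text \<open>
  The linear orders are indexed by \<open>0, \<dots>, b - 1\<close>, and an element of \<open>{0,1}\<^sup>b\<close> is a list of
  \<open>b\<close> truth values.
\<close>

definition boolean_realizer ::
    "'a set \<Rightarrow> 'a rel \<Rightarrow> nat \<Rightarrow> (nat \<Rightarrow> 'a rel) \<Rightarrow> (bool list \<Rightarrow> bool) \<Rightarrow> bool" where
  "boolean_realizer X r b L decode \<longleftrightarrow>
     (\<forall>i<b. linear_order_on X (L i)) \<and>
     (\<forall>x\<in>X. \<forall>y\<in>X. x \<noteq> y \<longrightarrow>
        ((x, y) \<in> r \<longleftrightarrow> decode (map (\<lambda>i. (x, y) \<in> L i) [0..<b])))"

definition boolean_dimension :: "'a set \<Rightarrow> 'a rel \<Rightarrow> nat" where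
  "boolean_dimension X r = (LEAST b. \<exists>L decode. boolean_realizer X r b L decode)"

text \<open>
  A labelled directed graph is given by its vertex set, its arc set and a labelling. The
  labelling is a total function whose values outside the vertex set carry no information.
\<close>

inductive cw_construction :: "nat \<Rightarrow> 'a set \<Rightarrow> 'a rel \<Rightarrow> ('a \<Rightarrow> nat) \<Rightarrow> bool"
  for w :: nat where
  single: "lab v \<in> {1..w} \<Longrightarrow> cw_construction w {v} {} lab"
| disjoint_union:
    "\<lbrakk>cw_construction w V\<^sub>1 E\<^sub>1 lab\<^sub>1; cw_construction w V\<^sub>2 E\<^sub>2 lab\<^sub>2; V\<^sub>1 \<inter> V\<^sub>2 = {}\<rbrakk> \<Longrightarrow>
      cw_construction w (V\<^sub>1 \<union> V\<^sub>2) (E\<^sub>1 \<union> E\<^sub>2) (\<lambda>v. if v \<in> V\<^sub>1 then lab\<^sub>1 v else lab\<^sub>2 v)"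
| add_arcs:
    "\<lbrakk>cw_construction w V E lab; i \<in> {1..w}; j \<in> {1..w}; i \<noteq> j\<rbrakk> \<Longrightarrow>
      cw_construction w V (E \<union> {(u, v). u \<in> V \<and> v \<in> V \<and> lab u = i \<and> lab v = j}) lab"
| relabel:
    "\<lbrakk>cw_construction w V E lab; i \<in> {1..w}; j \<in> {1..w}\<rbrakk> \<Longrightarrow>
      cw_construction w V E (\<lambda>v. if lab v = i then j else lab v)"

text \<open>
  The operations never produce the graph without vertices; it is given cliquewidth \<open>0\<close>.
\<close>

definition cliquewidth :: "'a set \<Rightarrow> 'a rel \<Rightarrow> nat" where
  "cliquewidth V E = (if V = {} then 0 else LEAST w. \<exists>lab. cw_construction w V E lab)"

definition poset_cliquewidth :: "'a set \<Rightarrow> 'a rel \<Rightarrow> nat" where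
  "poset_cliquewidth X r = cliquewidth X {(x, y). (x, y) \<in> r \<and> x \<noteq> y}"

text \<open>
  Both parameters are invariant under isomorphism. Hence a bound valid for all finite posets
  of natural numbers is valid for finite posets over every type, so that a statement
  \<open>\<exists>b. \<forall>X r. \<dots>\<close> over an arbitrary type does not hide a dependence of \<open>b\<close> on that type.
\<close>

lemma cw_construction_arcs: "cw_construction w V E lab \<Longrightarrow> E \<subseteq> V \<times> V"
  by (induction rule: cw_construction.induct) auto

lemma cw_construction_image:
  assumes "cw_construction w V E lab" "inj_on f V"
  shows "\<exists>lab'. cw_construction w (f ` V) (map_prod f f ` E) lab' \<and> (\<forall>v\<in>V. lab' (f v) = lab v)"
  using assms
proof (induction rule: cw_construction.induct)
  case (single lab v)
  then show ?case
    using cw_construction.single[of "\<lambda>_. lab v" "f v" w] by auto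
next
  case (disjoint_union V1 E1 lab1 V2 E2 lab2)
  from disjoint_union obtain l1 where l1: "cw_construction w (f ` V1) (map_prod f f ` E1) l1"
    "\<forall>v\<in>V1. l1 (f v) = lab1 v" by (auto simp: inj_on_Un)
  from disjoint_union obtain l2 where l2: "cw_construction w (f ` V2) (map_prod f f ` E2) l2"
    "\<forall>v\<in>V2. l2 (f v) = lab2 v" by (auto simp: inj_on_Un)
  have dj: "f ` V1 \<inter> f ` V2 = {}"
    using disjoint_union.prems disjoint_union.hyps by (auto simp: inj_on_def)
  show ?case
    using cw_construction.disjoint_union[OF l1(1) l2(1) dj] l1(2) l2(2) dj
    by (intro exI[of _ "\<lambda>v. if v \<in> f ` V1 then l1 v else l2 v"])
       (auto simp: image_Un)
next
  case (add_arcs V E lab i j)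
  then obtain l where l: "cw_construction w (f ` V) (map_prod f f ` E) l"
    "\<forall>v\<in>V. l (f v) = lab v" by auto
  have "map_prod f f ` (E \<union> {(u, v). u \<in> V \<and> v \<in> V \<and> lab u = i \<and> lab v = j}) =
    map_prod f f ` E \<union> {(u, v). u \<in> f ` V \<and> v \<in> f ` V \<and> l u = i \<and> l v = j}"
    using l(2) by (force simp: image_Un)
  then show ?case
    using cw_construction.add_arcs[OF l(1) add_arcs.hyps(2-4)] l(2) by auto
next
  case (relabel V E lab i j)
  then obtain l where l: "cw_construction w (f ` V) (map_prod f f ` E) l"
    "\<forall>v\<in>V. l (f v) = lab v" by auto
  then show ?case
    using cw_construction.relabel[OF l(1) relabel.hyps(2,3)] by fastforce
qed

lemma map_prod_inv_into:
  assumes "inj_on f X" "E \<subseteq> X \<times> X"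
  shows "map_prod (inv_into X f) (inv_into X f) ` map_prod f f ` E = E"
proof -
  have "map_prod (inv_into X f) (inv_into X f) (map_prod f f p) = p" if "p \<in> E" for p
    using that assms by (cases p) auto
  then show ?thesis by (simp add: image_image)
qed

lemma cliquewidth_image:
  assumes "inj_on f V" "E \<subseteq> V \<times> V"
  shows "cliquewidth (f ` V) (map_prod f f ` E) = cliquewidth V E"
proof -
  have "(\<exists>lab. cw_construction w (f ` V) (map_prod f f ` E) lab) \<longleftrightarrow>
        (\<exists>lab. cw_construction w V E lab)" for w
  proof
    assume "\<exists>lab. cw_construction w (f ` V) (map_prod f f ` E) lab"
    then obtain lab where "cw_construction w (f ` V) (map_prod f f ` E) lab" ..
    from cw_construction_image[OF this inj_on_inv_into[OF order_refl]]
    show "\<exists>lab. cw_construction w V E lab"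
      using assms(1) by (auto simp: map_prod_inv_into[OF assms])
  next
    assume "\<exists>lab. cw_construction w V E lab"
    then show "\<exists>lab. cw_construction w (f ` V) (map_prod f f ` E) lab"
      using cw_construction_image assms(1) by blast
  qed
  then show ?thesis by (simp add: cliquewidth_def)
qed

lemma partial_order_on_image:
  assumes "inj_on f X" "partial_order_on X r"
  shows "partial_order_on (f ` X) (map_prod f f ` r)"
proof -
  have r: "r \<subseteq> X \<times> X" "refl_on X r" "trans r" "antisym r"
    using assms(2) by (auto simp: partial_order_on_def preorder_on_def)
  have "refl_on (f ` X) (map_prod f f ` r)"
    using r(2) by (force simp: refl_on_def)
  moreover have "trans (map_prod f f ` r)"
  proof (rule transI)
    fix a b c assume "(a, b) \<in> map_prod f f ` r" "(b, c) \<in> map_prod f f ` r"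
    then obtain x y y' z where "(x, y) \<in> r" "(y', z) \<in> r" "a = f x" "b = f y" "b = f y'" "c = f z"
      by auto
    moreover from this have "y = y'" using r(1) assms(1) by (auto simp: inj_on_def)
    ultimately show "(a, c) \<in> map_prod f f ` r" using r(3) by (force dest: transD)
  qed
  moreover have "antisym (map_prod f f ` r)"
  proof (rule antisymI)
    fix a b assume "(a, b) \<in> map_prod f f ` r" "(b, a) \<in> map_prod f f ` r"
    then obtain x y y' x' where *: "(x, y) \<in> r" "(y', x') \<in> r" "a = f x" "b = f y" "b = f y'" "a = f x'"
      by auto
    then have "y = y'" "x = x'" using r(1) assms(1) by (auto simp: inj_on_def)
    with * show "a = b" using r(4) by (auto dest: antisymD)
  qed
  ultimately show ?thesis using r(1) by (auto simp: partial_order_on_def preorder_on_def)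
qed

lemma linear_order_on_image:
  assumes "inj_on f X" "linear_order_on X r"
  shows "linear_order_on (f ` X) (map_prod f f ` r)"
  using assms partial_order_on_image[of f X r]
  by (force simp: linear_order_on_def total_on_def)

lemma map_prod_image_iff:
  assumes "inj_on f X" "r \<subseteq> X \<times> X" "x \<in> X" "y \<in> X"
  shows "(f x, f y) \<in> map_prod f f ` r \<longleftrightarrow> (x, y) \<in> r"
proof
  assume "(f x, f y) \<in> map_prod f f ` r"
  then obtain u v where uv: "(u, v) \<in> r" "f x = f u" "f y = f v" by auto
  then have "x = u" "y = v" using assms by (auto dest: inj_onD)
  with uv show "(x, y) \<in> r" by simp
qed (rule map_prod_imageI)

lemma boolean_realizer_image:
  assumes "inj_on f X" "r \<subseteq> X \<times> X" "boolean_realizer X r b L decode"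
  shows "boolean_realizer (f ` X) (map_prod f f ` r) b (\<lambda>i. map_prod f f ` L i) decode"
proof -
  have L: "linear_order_on X (L i)" "L i \<subseteq> X \<times> X" if "i < b" for i
    using assms(3) that by (simp_all add: boolean_realizer_def order_on_defs)
  have "(f x, f y) \<in> map_prod f f ` r \<longleftrightarrow>
      decode (map (\<lambda>i. (f x, f y) \<in> map_prod f f ` L i) [0..<b])"
    if "x \<in> X" "y \<in> X" "f x \<noteq> f y" for x y
  proof -
    have "map (\<lambda>i. (f x, f y) \<in> map_prod f f ` L i) [0..<b] = map (\<lambda>i. (x, y) \<in> L i) [0..<b]"
    proof (rule map_cong[OF refl])
      fix i assume "i \<in> set [0..<b]"
      then show "(f x, f y) \<in> map_prod f f ` L i \<longleftrightarrow> (x, y) \<in> L i"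
        using map_prod_image_iff[OF assms(1) L(2) that(1,2)] by simp
    qed
    moreover have "(x, y) \<in> r \<longleftrightarrow> decode (map (\<lambda>i. (x, y) \<in> L i) [0..<b])"
    proof -
      have "x \<noteq> y" using that(3) by auto
      with assms(3) that(1,2) show ?thesis
        unfolding boolean_realizer_def by (elim conjE) (drule (1) bspec, drule (1) bspec, drule (1) mp)
    qed
    ultimately show ?thesis
      using map_prod_image_iff[OF assms(1,2) that(1,2)] by (simp only:)
  qed
  moreover have "linear_order_on (f ` X) (map_prod f f ` L i)" if "i < b" for i
    using linear_order_on_image[OF assms(1) L(1)[OF that]] .
  ultimately show ?thesis
    unfolding boolean_realizer_def ball_simps by metis
qed

lemma boolean_dimension_image:
  assumes "inj_on f X" "r \<subseteq> X \<times> X"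
  shows "boolean_dimension (f ` X) (map_prod f f ` r) = boolean_dimension X r"
proof -
  have sub: "map_prod f f ` r \<subseteq> f ` X \<times> f ` X" using assms(2) by auto
  have "(\<exists>L d. boolean_realizer (f ` X) (map_prod f f ` r) b L d) \<longleftrightarrow>
        (\<exists>L d. boolean_realizer X r b L d)" for b
  proof
    assume "\<exists>L d. boolean_realizer (f ` X) (map_prod f f ` r) b L d"
    then obtain L d where "boolean_realizer (f ` X) (map_prod f f ` r) b L d"
      by (elim exE)
    from boolean_realizer_image[OF inj_on_inv_into[OF order_refl] sub this]
    have "boolean_realizer X r b
        (\<lambda>i. map_prod (inv_into X f) (inv_into X f) ` L i) d"
      using assms(1) by (simp only: map_prod_inv_into[OF assms] inv_into_image_cancel order_refl)
    then show "\<exists>L d. boolean_realizer X r b L d" by (intro exI)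
  next
    assume "\<exists>L d. boolean_realizer X r b L d"
    then obtain L d where "boolean_realizer X r b L d"
      by (elim exE)
    from boolean_realizer_image[OF assms this]
    show "\<exists>L d. boolean_realizer (f ` X) (map_prod f f ` r) b L d" by (intro exI)
  qed
  then show ?thesis by (simp add: boolean_dimension_def)
qed

lemma bound_transfer:
  fixes X :: "'a set"
  assumes bound: "\<And>(Y :: nat set) s. finite Y \<Longrightarrow> partial_order_on Y s \<Longrightarrow>
      poset_cliquewidth Y s \<le> w \<Longrightarrow> boolean_dimension Y s \<le> b"
    and X: "finite X" "partial_order_on X r" "poset_cliquewidth X r \<le> w"
  shows "boolean_dimension X r \<le> b"
proof -
  obtain f :: "'a \<Rightarrow> nat" where f: "inj_on f X"
    using finite_imp_inj_to_nat_seg[OF X(1)] by auto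
  have r: "r \<subseteq> X \<times> X" using X(2) by (auto simp: order_on_defs)
  have "{(x, y). (x, y) \<in> map_prod f f ` r \<and> x \<noteq> y} =
        map_prod f f ` {(x, y). (x, y) \<in> r \<and> x \<noteq> y}"
    using f r by (force simp: inj_on_def)
  moreover have "{(x, y). (x, y) \<in> r \<and> x \<noteq> y} \<subseteq> X \<times> X" using r by auto
  ultimately have "poset_cliquewidth (f ` X) (map_prod f f ` r) = poset_cliquewidth X r"
    using cliquewidth_image[OF f] by (simp add: poset_cliquewidth_def)
  then have "boolean_dimension (f ` X) (map_prod f f ` r) \<le> b"
    using bound X partial_order_on_image[OF f X(2)] by simp
  then show ?thesis using boolean_dimension_image[OF f r] by simp
qed

end

theory Submission
  imports Defs
begin


text \<open>
  A construction with \<open>w\<close> labels is a tree of disjoint unions. The vertex sets occurring at its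
  unions form a laminar family, and two distinct vertices \<open>x\<close>, \<open>y\<close> first come together in the
  smallest member \<open>m\<close> containing both, their meet. Vertices with the same label in \<open>m\<close> are treated
  alike from then on, so whether \<open>(x, y)\<close> is an arc depends only on the labels of \<open>x\<close> and \<open>y\<close>
  in \<open>m\<close> and on a relation between labels attached to \<open>m\<close>, which records the arcs added later
  (\<open>cw_construction_representation\<close>). It therefore suffices to read off two kinds of information
  about a pair \<open>(x, y)\<close> from boundedly many linear orders: a function of the meet with finitely many
  values, and the label of \<open>x\<close> in the meet.

  The basic tool is gluing (\<open>decodable_glue\<close>). Given a hierarchy of nested sets and for each of
  its members \<open>s\<close> a linear order, all pairs can be compared by one linear order of the whole set that
  treats a pair with smallest common member \<open>s\<close> as the order of \<open>s\<close> treats representatives of the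
  two parts of \<open>s\<close> that contain the pair. For a function of the meet, glue one fixed order, reversed
  at the members where a given predicate holds: comparing the glued order with the glue of the
  unreversed order reveals the predicate (\<open>decodable_meet_predicate\<close>).

  The label of \<open>x\<close> in the meet is handled by induction on the number \<open>k\<close> of labels that occur in one
  member of the family (\<open>decodable_label_at_meet\<close>). Walk from the largest members downwards, and
  call a member a cut if the labels in every larger cut are constant on it. Fix a cut \<open>s\<close> and look at the
  members \<open>t\<close> for which \<open>s\<close> is the smallest cut above. Either all points of \<open>t\<close> have the same label
  in \<open>t\<close>, which is then a function of the meet, or the labels in \<open>s\<close> are not constant on \<open>t\<close>. In
  the latter case the points of \<open>t\<close> split according to their label in \<open>s\<close>, points from different
  parts have different labels in \<open>t\<close>, and so each part sees fewer labels. The label in \<open>s\<close> depends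
  on \<open>x\<close> only, and the induction hypothesis yields orders for the block of \<open>s\<close>. It remains to glue
  the orders of all blocks. This needs that representatives carry the right labels, and
  that holds for cuts two levels further down: if \<open>c\<close>, \<open>e\<close>, \<open>s\<close> are nested cuts, the labels in \<open>e\<close>,
  hence in every member between \<open>e\<close> and \<open>s\<close>, are constant on \<open>c\<close>. Hence one glues separately along the
  cuts of even and of odd depth, and the parity of the depth is a function of the meet.
\<close>

section \<open>Queries decoded from boundedly many linear orders\<close>

definition order_bits :: "nat \<Rightarrow> (nat \<Rightarrow> 'a rel) \<Rightarrow> 'a \<Rightarrow> 'a \<Rightarrow> bool list" where
  "order_bits b L x y = map (\<lambda>i. (x, y) \<in> L i) [0..<b]"

text \<open>
  An index \<open>j\<close> stands for one instance: a set \<open>X j\<close>, the pairs \<open>W j\<close> of interest and a query about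
  them. The orders may depend on the instance, whereas their number and the decoding function may
  not. Uniformity in \<open>j\<close> is what makes a bound depend on the width only, and it also allows the
  orders of many parts of one set to be glued under a common decoding function.
\<close>

definition decodes ::
    "'j set \<Rightarrow> ('j \<Rightarrow> 'a set) \<Rightarrow> ('j \<Rightarrow> 'a rel) \<Rightarrow> ('j \<Rightarrow> 'a \<Rightarrow> 'a \<Rightarrow> 'c) \<Rightarrow>
     nat \<Rightarrow> ('j \<Rightarrow> nat \<Rightarrow> 'a rel) \<Rightarrow> (bool list \<Rightarrow> 'c) \<Rightarrow> bool" where
  "decodes J X W Q b L dec \<longleftrightarrow>
     (\<forall>j\<in>J. \<forall>i<b. linear_order_on (X j) (L j i)) \<and>
     (\<forall>j\<in>J. \<forall>x y. (x, y) \<in> W j \<longrightarrow> Q j x y = dec (order_bits b (L j) x y))"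

definition decodable ::
    "'j set \<Rightarrow> ('j \<Rightarrow> 'a set) \<Rightarrow> ('j \<Rightarrow> 'a rel) \<Rightarrow> ('j \<Rightarrow> 'a \<Rightarrow> 'a \<Rightarrow> 'c) \<Rightarrow> bool" where
  "decodable J X W Q \<longleftrightarrow> (\<exists>b L dec. decodes J X W Q b L dec)"

lemma decodableE:
  assumes "decodable J X W Q"
  obtains b L dec where "decodes J X W Q b L dec"
  using assms unfolding decodable_def by (elim exE)

lemma decodableI:
  assumes "\<And>j i. j \<in> J \<Longrightarrow> i < b \<Longrightarrow> linear_order_on (X j) (L j i)"
    and "\<And>j x y. j \<in> J \<Longrightarrow> (x, y) \<in> W j \<Longrightarrow> Q j x y = dec (order_bits b (L j) x y)"
  shows "decodable J X W Q"
  unfolding decodable_def decodes_def using assms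
  by (intro exI[of _ b] exI[of _ L] exI[of _ dec]) simp

lemma decodable_mono:
  assumes "decodable J X W Q"
    and "\<And>j. j \<in> J' \<Longrightarrow> g j \<in> J"
    and "\<And>j. j \<in> J' \<Longrightarrow> X' j = X (g j)"
    and "\<And>j x y. j \<in> J' \<Longrightarrow> (x, y) \<in> W' j \<Longrightarrow> (x, y) \<in> W (g j)"
    and "\<And>j x y. j \<in> J' \<Longrightarrow> (x, y) \<in> W' j \<Longrightarrow> Q' j x y = Q (g j) x y"
  shows "decodable J' X' W' Q'"
proof -
  obtain b L dec where "decodes J X W Q b L dec"
    by (rule decodableE[OF assms(1)])
  then show ?thesis
    using assms(2-) unfolding decodes_def
    by (intro decodableI[where L = "\<lambda>j. L (g j)" and b = b and dec = dec]) simp_all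
qed

lemmas decodable_subset = decodable_mono[where g = "\<lambda>j. j", OF _ _ refl]

lemma decodable_const: "(\<And>j x y. j \<in> J \<Longrightarrow> (x, y) \<in> W j \<Longrightarrow> Q j x y = c) \<Longrightarrow> decodable J X W Q"
  by (rule decodableI[where b = 0 and dec = "\<lambda>_. c"]) auto

lemma decodable_map:
  assumes "decodable J X W Q"
  shows "decodable J X W (\<lambda>j x y. h (Q j x y))"
proof -
  obtain b L dec where "decodes J X W Q b L dec"
    by (rule decodableE[OF assms])
  then show ?thesis
    unfolding decodes_def
    by (intro decodableI[where L = L and b = b and dec = "\<lambda>l. h (dec l)"]) simp_all
qed

lemma order_bits_append:
  "order_bits (b + b') (\<lambda>i. if i < b then L i else L' (i - b)) x y =
   order_bits b L x y @ order_bits b' L' x y"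
  unfolding order_bits_def by (rule nth_equalityI) (auto simp: nth_append)

lemma length_order_bits [simp]: "length (order_bits b L x y) = b"
  by (simp add: order_bits_def)

lemma nth_order_bits [simp]: "i < b \<Longrightarrow> order_bits b L x y ! i \<longleftrightarrow> (x, y) \<in> L i"
  by (simp add: order_bits_def)

lemma decodable_pair:
  assumes "decodable J X W\<^sub>1 Q\<^sub>1" "decodable J X W\<^sub>2 Q\<^sub>2"
  obtains b L d\<^sub>1 d\<^sub>2 where "decodes J X W\<^sub>1 Q\<^sub>1 b L d\<^sub>1" "decodes J X W\<^sub>2 Q\<^sub>2 b L d\<^sub>2"
proof -
  obtain b1 L1 d1 where 1: "decodes J X W\<^sub>1 Q\<^sub>1 b1 L1 d1"
    by (rule decodableE[OF assms(1)])
  obtain b2 L2 d2 where 2: "decodes J X W\<^sub>2 Q\<^sub>2 b2 L2 d2"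
    by (rule decodableE[OF assms(2)])
  let ?L = "\<lambda>j i. if i < b1 then L1 j i else L2 j (i - b1)"
  have "decodes J X W\<^sub>1 Q\<^sub>1 (b1 + b2) ?L (\<lambda>l. d1 (take b1 l))"
    "decodes J X W\<^sub>2 Q\<^sub>2 (b1 + b2) ?L (\<lambda>l. d2 (drop b1 l))"
    using 1 2 by (simp_all add: decodes_def order_bits_append)
  then show ?thesis by (rule that)
qed

text \<open>
  The case distinction is itself a query, so each case may be decoded on its own pairs only. Outside
  these pairs the decoding function of that case returns garbage, which the options discard.
\<close>

lemma decodable_if:
  assumes P: "decodable J X W P"
    and 1: "decodable J X (\<lambda>j. {(x, y)\<in>W j. P j x y}) Q"
    and 2: "decodable J X (\<lambda>j. {(x, y)\<in>W j. \<not> P j x y}) Q"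
  shows "decodable J X W Q"
proof -
  have restrict: "decodable J X W (\<lambda>j x y. if P j x y = p then Some (Q j x y) else None)"
    if Q: "decodable J X (\<lambda>j. {(x, y)\<in>W j. P j x y = p}) Q" for p
  proof -
    obtain b L dP dQ where "decodes J X W P b L dP"
      "decodes J X (\<lambda>j. {(x, y)\<in>W j. P j x y = p}) Q b L dQ"
      by (rule decodable_pair[OF P Q])
    then show ?thesis unfolding decodes_def
      by (intro decodableI[where L = L and b = b
            and dec = "\<lambda>l. if dP l = p then Some (dQ l) else None"]) simp_all
  qed
  have 1: "decodable J X W (\<lambda>j x y. if P j x y = True then Some (Q j x y) else None)"
    by (rule restrict) (use 1 in simp)
  have 2: "decodable J X W (\<lambda>j x y. if P j x y = False then Some (Q j x y) else None)"
    by (rule restrict) (use 2 in simp)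
  obtain b L d1 d2 where
    d1: "decodes J X W (\<lambda>j x y. if P j x y = True then Some (Q j x y) else None) b L d1" and
    d2: "decodes J X W (\<lambda>j x y. if P j x y = False then Some (Q j x y) else None) b L d2"
    by (rule decodable_pair[OF 1 2])
  show ?thesis
  proof (rule decodableI[where L = L and b = b
          and dec = "\<lambda>l. case d1 l of Some q \<Rightarrow> q | None \<Rightarrow> the (d2 l)"])
    fix j x y assume *: "j \<in> J" "(x, y) \<in> W j"
    then have "d1 (order_bits b (L j) x y) = (if P j x y = True then Some (Q j x y) else None)"
      "d2 (order_bits b (L j) x y) = (if P j x y = False then Some (Q j x y) else None)"
      using d1 d2 unfolding decodes_def by simp_all
    then show "Q j x y = (case d1 (order_bits b (L j) x y) of Some q \<Rightarrow> q
        | None \<Rightarrow> the (d2 (order_bits b (L j) x y)))"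
      by simp
  qed (use d1 in \<open>simp add: decodes_def\<close>)
qed

lemma decodable_cases:
  assumes "finite V"
    and "\<And>j x y. j \<in> J \<Longrightarrow> (x, y) \<in> W j \<Longrightarrow> C j x y \<in> V"
    and "\<And>v. v \<in> V \<Longrightarrow> decodable J X W (\<lambda>j x y. C j x y = v)"
    and "\<And>v. v \<in> V \<Longrightarrow> decodable J X (\<lambda>j. {(x, y)\<in>W j. C j x y = v}) Q"
  shows "decodable J X W Q"
  using assms
proof (induction V arbitrary: W rule: finite_induct)
  case empty
  then show ?case by (intro decodable_const) auto
next
  case (insert v V)
  show ?case
  proof (rule decodable_if[where P = "\<lambda>j x y. C j x y = v"])
    show "decodable J X (\<lambda>j. {(x, y). (x, y) \<in> W j \<and> C j x y \<noteq> v}) Q"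
    proof (rule insert.IH)
      fix u assume u: "u \<in> V"
      show "decodable J X (\<lambda>j. {(x, y). (x, y) \<in> W j \<and> C j x y \<noteq> v}) (\<lambda>j x y. C j x y = u)"
        by (rule decodable_subset[OF insert.prems(2)[of u]]) (use u in auto)
      show "decodable J X (\<lambda>j. {(x, y). (x, y) \<in> {(x, y). (x, y) \<in> W j \<and> C j x y \<noteq> v} \<and> C j x y = u}) Q"
        by (rule decodable_subset[OF insert.prems(3)[of u]]) (use u in auto)
    qed (use insert.prems in auto)
  qed (use insert.prems in auto)
qed

lemma decodable_finite_valued:
  assumes "finite V"
    and "\<And>j x y. j \<in> J \<Longrightarrow> (x, y) \<in> W j \<Longrightarrow> Q j x y \<in> V"
    and "\<And>v. v \<in> V \<Longrightarrow> decodable J X W (\<lambda>j x y. Q j x y = v)"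
  shows "decodable J X W Q"
  using assms by (rule decodable_cases[where C = Q]) (auto intro: decodable_const)

lemma decodable_swap:
  assumes "decodable J X W Q"
  shows "decodable J X (\<lambda>j. (W j)\<inverse>) (\<lambda>j x y. Q j y x)"
proof -
  obtain b L dec where "decodes J X W Q b L dec"
    by (rule decodableE[OF assms])
  moreover have "order_bits b (\<lambda>i. (L j i)\<inverse>) x y = order_bits b (L j) y x" for j x y
    by (simp add: order_bits_def)
  ultimately show ?thesis unfolding decodes_def
    by (intro decodableI[where L = "\<lambda>j i. (L j i)\<inverse>" and b = b and dec = dec]) simp_all
qed

definition key_order :: "'a set \<Rightarrow> ('a \<Rightarrow> int) \<Rightarrow> 'a rel" where
  "key_order X f = {(x, y). x \<in> X \<and> y \<in> X \<and> f x \<le> f y}"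

lemma linear_order_on_key_order: "inj_on f X \<Longrightarrow> linear_order_on X (key_order X f)"
  unfolding key_order_def
  by (auto simp: order_on_defs refl_on_def trans_def antisym_def total_on_def inj_on_def)

lemma ex_bounded_inj_on:
  assumes "finite X"
  shows "\<exists>(f :: 'a \<Rightarrow> int) N. inj_on f X \<and> (\<forall>x\<in>X. 0 \<le> f x \<and> f x < N)"
proof -
  obtain g :: "'a \<Rightarrow> nat" and n where g: "inj_on g X" "g ` X = {i. i < n}"
    using finite_imp_inj_to_nat_seg[OF assms] by auto
  then have "inj_on (\<lambda>x. int (g x)) X" "\<forall>x\<in>X. 0 \<le> int (g x) \<and> int (g x) < int n"
    by (auto simp: inj_on_def)
  then show ?thesis by blast
qed

text \<open>
  One bit about the instance is stored by taking the same order twice or reversing the second copy.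
\<close>

lemma decodable_index_property:
  fixes X :: "'j \<Rightarrow> 'a set" and P :: "'j \<Rightarrow> bool"
  assumes fin: "\<And>j. j \<in> J \<Longrightarrow> finite (X j)"
    and W: "\<And>j. j \<in> J \<Longrightarrow> W j \<subseteq> X j \<times> X j - Id"
  shows "decodable J X W (\<lambda>j x y. P j)"
proof -
  have "\<forall>j\<in>J. \<exists>f :: 'a \<Rightarrow> int. inj_on f (X j)"
    using ex_bounded_inj_on[OF fin] by blast
  from bchoice[OF this] obtain f :: "'j \<Rightarrow> 'a \<Rightarrow> int" where f: "\<And>j. j \<in> J \<Longrightarrow> inj_on (f j) (X j)"
    by blast
  define g where "g j i x = (if i = 0 \<or> P j then f j x else - f j x)" for j x and i :: nat
  show ?thesis
  proof (rule decodableI[where b = 2 and dec = "\<lambda>l. l ! 0 = l ! 1" and L = "\<lambda>j i. key_order (X j) (g j i)"])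
    fix j i assume "j \<in> J"
    then show "linear_order_on (X j) (key_order (X j) (g j i))"
      using f by (intro linear_order_on_key_order) (auto simp: inj_on_def g_def)
  next
    fix j x y assume *: "j \<in> J" "(x, y) \<in> W j"
    then have "x \<in> X j" "y \<in> X j" "f j x \<noteq> f j y"
      using W[of j] f[of j] by (auto simp: inj_on_def)
    then show "P j = (\<lambda>l. l ! 0 = l ! 1) (order_bits 2 (\<lambda>i. key_order (X j) (g j i)) x y)"
      by (auto simp: key_order_def g_def)
  qed
qed

text \<open>
  All three orders place the points satisfying \<open>P\<close> before the others. The first two have opposite
  directions inside the two classes, so they agree exactly on pairs from different classes, and then
  the first order tells which point satisfies \<open>P\<close>. For a pair inside one class, the third order agrees
  with the first one on the class of \<open>P\<close> and with the second one on its complement.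
\<close>

lemma decodable_left_predicate:
  fixes X :: "'j \<Rightarrow> 'a set" and P :: "'j \<Rightarrow> 'a \<Rightarrow> bool"
  assumes fin: "\<And>j. j \<in> J \<Longrightarrow> finite (X j)"
    and W: "\<And>j. j \<in> J \<Longrightarrow> W j \<subseteq> X j \<times> X j - Id"
  shows "decodable J X W (\<lambda>j x y. P j x)"
proof -
  have "\<forall>j\<in>J. \<exists>p. inj_on (fst p :: 'a \<Rightarrow> int) (X j) \<and> (\<forall>x\<in>X j. 0 \<le> fst p x \<and> fst p x < snd p)"
    using ex_bounded_inj_on[OF fin] by simp
  from bchoice[OF this] obtain p :: "'j \<Rightarrow> ('a \<Rightarrow> int) \<times> int"
    where p: "\<forall>j\<in>J. inj_on (fst (p j)) (X j) \<and> (\<forall>x\<in>X j. 0 \<le> fst (p j) x \<and> fst (p j) x < snd (p j))"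
    by (elim exE)
  define f N where "f j = fst (p j)" and "N j = snd (p j)" for j
  have f: "inj_on (f j) (X j)" and N: "\<And>x. x \<in> X j \<Longrightarrow> 0 \<le> f j x \<and> f j x < N j" if "j \<in> J" for j
    using p that by (auto simp: f_def N_def)
  \<comment> \<open>As \<open>f\<close> takes values in \<open>{0..<N}\<close>, the offsets put the keys of the points violating \<open>P\<close> above
    those of the points satisfying \<open>P\<close>, in all three orders.\<close>
  define g where "g j i x = (if P j x then (if i = 1 then - f j x else f j x)
     else (if i = 0 then N j + f j x else if i = 1 then N j - f j x else 2 * N j - f j x))"
    for j x and i :: nat
  show ?thesis
  proof (rule decodableI[where b = 3 and L = "\<lambda>j i. key_order (X j) (g j i)"
        and dec = "\<lambda>l. if l ! 0 = l ! 1 then l ! 0 else l ! 0 = l ! 2"])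
    fix j i assume j: "j \<in> J"
    have "x = y" if "x \<in> X j" "y \<in> X j" "g j i x = g j i y" for x y
    proof -
      have "f j x = f j y"
        using that N[OF j that(1)] N[OF j that(2)] unfolding g_def by (auto split: if_splits)
      then show ?thesis using f[OF j] that by (auto simp: inj_on_def)
    qed
    then show "linear_order_on (X j) (key_order (X j) (g j i))"
      by (intro linear_order_on_key_order inj_onI)
  next
    fix j x y assume *: "j \<in> J" "(x, y) \<in> W j"
    then have xy: "x \<in> X j" "y \<in> X j" and "f j x \<noteq> f j y"
      using W[of j] f[of j] by (auto simp: inj_on_def)
    then have "P j x = (if (g j 0 x \<le> g j 0 y) = (g j 1 x \<le> g j 1 y) then g j 0 x \<le> g j 0 y
        else (g j 0 x \<le> g j 0 y) = (g j 2 x \<le> g j 2 y))"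
      using N[OF *(1) xy(1)] N[OF *(1) xy(2)] by (auto simp: g_def)
    then show "P j x = (\<lambda>l. if l ! 0 = l ! 1 then l ! 0 else l ! 0 = l ! 2)
        (order_bits 3 (\<lambda>i. key_order (X j) (g j i)) x y)"
      using xy by (simp add: key_order_def)
  qed
qed

section \<open>Laminar families and hierarchies\<close>

lemma chain_Inter_Union_mem:
  assumes "finite S" "S \<noteq> {}" "\<And>s t. s \<in> S \<Longrightarrow> t \<in> S \<Longrightarrow> s \<subseteq> t \<or> t \<subseteq> s"
  shows "\<Inter>S \<in> S \<and> \<Union>S \<in> S"
  using assms
proof (induction S rule: finite_ne_induct)
  case (insert a S)
  then have "\<Inter>S \<in> S" "\<Union>S \<in> S" by auto
  moreover from this have "a \<subseteq> \<Inter>S \<or> \<Inter>S \<subseteq> a" "a \<subseteq> \<Union>S \<or> \<Union>S \<subseteq> a"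
    using insert.prems by blast+
  ultimately show ?case
    by (auto simp: Int_absorb1 Int_absorb2 Un_absorb1 Un_absorb2)
qed simp

definition laminar :: "'a set \<Rightarrow> 'a set set \<Rightarrow> bool" where
  "laminar X F \<longleftrightarrow> finite X \<and> (\<forall>t\<in>F. t \<noteq> {} \<and> t \<subseteq> X) \<and>
     (\<forall>s\<in>F. \<forall>t\<in>F. s \<subseteq> t \<or> t \<subseteq> s \<or> s \<inter> t = {})"

definition meet :: "'a set set \<Rightarrow> 'a \<Rightarrow> 'a \<Rightarrow> 'a set" where
  "meet F x y = \<Inter>{t \<in> F. x \<in> t \<and> y \<in> t}"

text \<open>
  If the family contains the singletons, this is the part of the meet of \<open>x\<close> and \<open>y\<close> that contains
  \<open>x\<close>: the child of the meet in the direction of \<open>x\<close>.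
\<close>

definition side :: "'a set set \<Rightarrow> 'a \<Rightarrow> 'a \<Rightarrow> 'a set" where
  "side F x y = \<Union>{t \<in> F. x \<in> t \<and> y \<notin> t}"

lemma laminarI:
  assumes "finite X" "\<And>t. t \<in> F \<Longrightarrow> t \<noteq> {}" "\<And>t. t \<in> F \<Longrightarrow> t \<subseteq> X"
    and "\<And>s t. s \<in> F \<Longrightarrow> t \<in> F \<Longrightarrow> s \<subseteq> t \<or> t \<subseteq> s \<or> s \<inter> t = {}"
  shows "laminar X F"
  using assms by (simp add: laminar_def)

lemma laminarD:
  assumes "laminar X F"
  shows "finite X" "t \<in> F \<Longrightarrow> t \<noteq> {}" "t \<in> F \<Longrightarrow> t \<subseteq> X"
    and "s \<in> F \<Longrightarrow> t \<in> F \<Longrightarrow> s \<subseteq> t \<or> t \<subseteq> s \<or> s \<inter> t = {}"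
  using assms by (simp_all add: laminar_def)

lemma laminar_comparable:
  assumes "laminar X F" "s \<in> F" "t \<in> F" "x \<in> s" "x \<in> t"
  shows "s \<subseteq> t \<or> t \<subseteq> s"
  using laminarD(4)[OF assms(1-3)] assms(4,5) by blast

lemma laminar_subset:
  assumes "laminar X F" "G \<subseteq> F"
  shows "laminar X G"
proof (rule laminarI)
  fix s t assume "s \<in> G" "t \<in> G"
  with assms(2) have "s \<in> F" "t \<in> F" by auto
  then show "s \<subseteq> t \<or> t \<subseteq> s \<or> s \<inter> t = {}" by (rule laminarD(4)[OF assms(1)])
next
  show "finite X" by (rule laminarD(1)[OF assms(1)])
next
  fix t assume "t \<in> G"
  with assms(2) have "t \<in> F" by auto
  then show "t \<noteq> {}" "t \<subseteq> X" by (rule laminarD(2,3)[OF assms(1)])+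
qed

lemma laminar_finite:
  assumes "laminar X F"
  shows "finite F"
proof (rule finite_subset)
  show "F \<subseteq> Pow X" using laminarD(3)[OF assms] by blast
  show "finite (Pow X)" using laminarD(1)[OF assms] by simp
qed

lemma meet_commute: "meet F x y = meet F y x"
  by (simp add: meet_def conj_commute)

lemma meet_left: "x \<in> meet F x y" and meet_right: "y \<in> meet F x y"
  by (auto simp: meet_def)

lemma meet_least: "t \<in> F \<Longrightarrow> x \<in> t \<Longrightarrow> y \<in> t \<Longrightarrow> meet F x y \<subseteq> t"
  by (auto simp: meet_def)

lemma meet_mem:
  assumes "laminar X F" "t \<in> F" "x \<in> t" "y \<in> t"
  shows "meet F x y \<in> F"
proof -
  let ?S = "{t \<in> F. x \<in> t \<and> y \<in> t}"
  have "\<Inter>?S \<in> ?S \<and> \<Union>?S \<in> ?S"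
    using assms laminar_finite[OF assms(1)] laminar_comparable[OF assms(1)]
    by (intro chain_Inter_Union_mem) auto
  then show ?thesis by (simp add: meet_def)
qed

lemma side_mem:
  assumes "laminar X F" "t \<in> F" "x \<in> t" "y \<notin> t"
  shows "side F x y \<in> F" "x \<in> side F x y" "y \<notin> side F x y"
proof -
  let ?S = "{t \<in> F. x \<in> t \<and> y \<notin> t}"
  have "\<Inter>?S \<in> ?S \<and> \<Union>?S \<in> ?S"
    using assms laminar_finite[OF assms(1)] laminar_comparable[OF assms(1)]
    by (intro chain_Inter_Union_mem) auto
  then show "side F x y \<in> F" "x \<in> side F x y" "y \<notin> side F x y"
    by (simp_all add: side_def)
qed

text \<open>
  Members comparable with \<open>c\<close> and \<open>d\<close> that contain a point of each contain both sets. The subfamily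
  \<open>F\<close> is there because the parts in which representatives are chosen may be singletons outside the
  family whose meets carry the labels.
\<close>

lemma meet_replace:
  assumes "laminar X C" "F \<subseteq> C" "c \<in> C" "d \<in> C" "c \<inter> d = {}"
    and "x \<in> c" "x' \<in> c" "y \<in> d" "y' \<in> d"
  shows "meet F x y = meet F x' y'"
proof -
  have "x \<in> t \<and> y \<in> t \<longleftrightarrow> c \<subseteq> t \<and> d \<subseteq> t" if "t \<in> F" for t
    using laminar_comparable[OF assms(1), of t c x] laminar_comparable[OF assms(1), of t d y]
      that assms by blast
  moreover have "x' \<in> t \<and> y' \<in> t \<longleftrightarrow> c \<subseteq> t \<and> d \<subseteq> t" if "t \<in> F" for t
    using laminar_comparable[OF assms(1), of t c x'] laminar_comparable[OF assms(1), of t d y']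
      that assms by blast
  ultimately have "{t \<in> F. x \<in> t \<and> y \<in> t} = {t \<in> F. x' \<in> t \<and> y' \<in> t}" by blast
  then show ?thesis by (simp add: meet_def)
qed

definition hierarchy :: "'a set \<Rightarrow> 'a set set \<Rightarrow> bool" where
  "hierarchy X C \<longleftrightarrow> laminar X C \<and> (X \<noteq> {} \<longrightarrow> X \<in> C) \<and> (\<forall>x\<in>X. {x} \<in> C)"

definition completion :: "'a set \<Rightarrow> 'a set set \<Rightarrow> 'a set set" where
  "completion X F = F \<union> (\<lambda>x. {x}) ` X \<union> ({X} - {{}})"

lemma hierarchy_completion: "laminar X F \<Longrightarrow> hierarchy X (completion X F)"
proof -
  assume F: "laminar X F"
  note F' = laminarD[OF F]
  have sub: "t \<noteq> {} \<and> t \<subseteq> X" if "t \<in> completion X F" for t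
    using that F'(2,3) by (auto simp: completion_def)
  have "s \<subseteq> t \<or> t \<subseteq> s \<or> s \<inter> t = {}"
    if st: "s \<in> completion X F" "t \<in> completion X F" for s t
  proof (cases "s \<in> F \<and> t \<in> F")
    case True
    then show ?thesis using F'(4) by simp
  next
    case False
    with st have "s = X \<or> t = X \<or> (\<exists>x. s = {x}) \<or> (\<exists>x. t = {x})"
      by (auto simp: completion_def)
    then show ?thesis using sub[OF st(1)] sub[OF st(2)] by auto
  qed
  then have "laminar X (completion X F)"
    using sub F'(1) by (intro laminarI) simp_all
  then show ?thesis by (auto simp: hierarchy_def completion_def)
qed

lemma meet_completion:
  assumes "laminar X F" "t \<in> F" "x \<in> t" "y \<in> t" "x \<noteq> y"
  shows "meet (completion X F) x y = meet F x y"
proof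
  have "t \<subseteq> X" using laminarD(3)[OF assms(1,2)] .
  then show "meet F x y \<subseteq> meet (completion X F) x y"
    using assms meet_least[OF assms(2-4)] by (auto simp: meet_def completion_def)
  show "meet (completion X F) x y \<subseteq> meet F x y"
    by (auto simp: meet_def completion_def)
qed

context
  fixes X :: "'a set" and C :: "'a set set"
  assumes hierarchy: "hierarchy X C"
begin

lemma hierarchy_laminar: "laminar X C"
  using hierarchy by (simp add: hierarchy_def)

lemma hierarchy_meet_mem: "x \<in> X \<Longrightarrow> y \<in> X \<Longrightarrow> meet C x y \<in> C"
  using hierarchy meet_mem[OF hierarchy_laminar, of X x y] by (auto simp: hierarchy_def)

lemma hierarchy_side:
  assumes "x \<in> X" "y \<in> X" "x \<noteq> y"
  shows "side C x y \<in> C" "x \<in> side C x y" "y \<notin> side C x y"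
  using hierarchy side_mem[OF hierarchy_laminar, of "{x}" x y] assms
  by (auto simp: hierarchy_def)

lemma hierarchy_side_disjoint:
  assumes "x \<in> X" "y \<in> X" "x \<noteq> y"
  shows "side C x y \<inter> side C y x = {}"
  using hierarchy_side[of x y] hierarchy_side[of y x] assms hierarchy_laminar
  unfolding laminar_def by blast

text \<open>
  Seen from a point outside a member, the points of this member are indistinguishable.
\<close>

lemma side_outside:
  assumes "m \<in> C" "x \<in> m" "y \<in> m" "z \<notin> m"
  shows "side C x z = side C y z" "side C z x = side C z y" "meet C x z = meet C y z"
proof -
  note cmp = laminar_comparable[OF hierarchy_laminar _ assms(1)]
  have "side C x z \<subseteq> side C y z" if "x \<in> m" "y \<in> m" for x y
    unfolding side_def using cmp[of _ x] that assms(1,4) by blast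
  then show "side C x z = side C y z" using assms(2,3) by blast
  have "x \<in> t \<longleftrightarrow> y \<in> t" if "t \<in> C" "z \<in> t" for t
    using cmp[of t x] cmp[of t y] that assms by blast
  then have "{t \<in> C. z \<in> t \<and> x \<notin> t} = {t \<in> C. z \<in> t \<and> y \<notin> t}"
    "{t \<in> C. x \<in> t \<and> z \<in> t} = {t \<in> C. y \<in> t \<and> z \<in> t}" by blast+
  then show "side C z x = side C z y" "meet C x z = meet C y z"
    by (simp_all add: side_def meet_def)
qed

text \<open>
  A pair is compared at its meet, through representatives of the two children of the meet.
\<close>

definition glued_order :: "('a set \<Rightarrow> 'a) \<Rightarrow> ('a set \<Rightarrow> 'a rel) \<Rightarrow> 'a rel" where
  "glued_order rep L = {(x, y). x \<in> X \<and> y \<in> X \<and>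
     (x = y \<or> (rep (side C x y), rep (side C y x)) \<in> L (meet C x y))}"

text \<open>
  Transitivity is the only delicate point. Of the three meets of \<open>x\<close>, \<open>y\<close>, \<open>z\<close> at least two coincide.
  If one meet is smaller, its two points cannot be distinguished by the third one; if all three
  coincide, the three points lie in three children of one member, whose order is transitive.
\<close>

lemma linear_order_on_glued_order:
  assumes rep: "\<And>c. c \<in> C \<Longrightarrow> rep c \<in> c"
    and L: "\<And>s. s \<in> C \<Longrightarrow> linear_order_on X (L s)"
  shows "linear_order_on X (glued_order rep L)"
proof -
  define R where "R x y \<longleftrightarrow> (rep (side C x y), rep (side C y x)) \<in> L (meet C x y)" for x y
  have L': "trans (L s)" "antisym (L s)" "total_on X (L s)" if "s \<in> C" for s
    using L[OF that] by (simp_all add: order_on_defs)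
  have rep_neq: "rep (side C x y) \<noteq> rep (side C y x)" "rep (side C x y) \<in> X"
    if "x \<in> X" "y \<in> X" "x \<noteq> y" for x y
  proof -
    have "rep (side C x y) \<in> side C x y" "rep (side C y x) \<in> side C y x"
      using rep hierarchy_side(1) that by auto
    moreover have "side C x y \<subseteq> X"
      using hierarchy_side(1)[OF that] hierarchy_laminar by (auto simp: laminar_def)
    ultimately show "rep (side C x y) \<noteq> rep (side C y x)" "rep (side C x y) \<in> X"
      using hierarchy_side_disjoint[OF that] by auto
  qed
  have anti: "\<not> R y x" if "x \<in> X" "y \<in> X" "x \<noteq> y" "R x y" for x y
    using rep_neq(1)[OF that(1-3)] L'(2)[OF hierarchy_meet_mem[OF that(1,2)]] that(4)
    unfolding R_def meet_commute[of C y x] by (auto dest: antisymD)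
  have tot: "R x y \<or> R y x" if "x \<in> X" "y \<in> X" "x \<noteq> y" for x y
    using rep_neq[of x y] rep_neq[of y x] that L'(3)[OF hierarchy_meet_mem[OF that(1,2)]]
    unfolding R_def meet_commute[of C y x] by (auto simp: total_on_def)
  have tr: "R x z" if X: "x \<in> X" "y \<in> X" "z \<in> X" and neq: "x \<noteq> y" "y \<noteq> z" "x \<noteq> z"
    and R: "R x y" "R y z" for x y z
  proof -
    note mem = hierarchy_meet_mem[OF X(1,2)] hierarchy_meet_mem[OF X(2,3)] hierarchy_meet_mem[OF X(1,3)]
    consider "z \<notin> meet C x y" | "x \<notin> meet C y z"
      | "z \<in> meet C x y" "x \<in> meet C y z" "y \<notin> meet C x z"
      | "z \<in> meet C x y" "x \<in> meet C y z" "y \<in> meet C x z" by blast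
    then show ?thesis
    proof cases
      case 1
      from side_outside[OF mem(1) meet_left meet_right 1] R(2) show ?thesis
        by (simp add: R_def)
    next
      case 2
      from side_outside[OF mem(2) meet_left meet_right 2] R(1) show ?thesis
        by (simp add: R_def meet_commute[of C x])
    next
      case 3
      from side_outside[OF mem(3) meet_left meet_right 3(3)] R(1) have "R z y"
        by (simp add: R_def)
      with anti[OF X(2,3) neq(2) R(2)] show ?thesis by simp
    next
      case 4
      have "x \<in> t \<and> y \<in> t \<longleftrightarrow> x \<in> t \<and> z \<in> t" "x \<in> t \<and> y \<in> t \<longleftrightarrow> y \<in> t \<and> z \<in> t"
        if "t \<in> C" for t
        using 4 that unfolding meet_def by blast+
      then have "side C x y = side C x z" "side C y x = side C y z" "side C z x = side C z y"
        "meet C x y = meet C x z" "meet C y z = meet C x z"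
        unfolding side_def meet_def by (metis (no_types, lifting))+
      with R show ?thesis
        unfolding R_def using L'(1)[OF mem(3)] by (simp add: trans_def)
    qed
  qed
  have eq: "glued_order rep L = {(x, y). x \<in> X \<and> y \<in> X \<and> (x = y \<or> R x y)}"
    by (simp add: glued_order_def R_def)
  have "refl_on X (glued_order rep L)"
    unfolding eq by (auto simp: refl_on_def)
  moreover have "trans (glued_order rep L)"
    unfolding eq trans_def using tr anti by blast
  moreover have "antisym (glued_order rep L)"
    unfolding eq antisym_def using anti by blast
  moreover have "total_on X (glued_order rep L)"
    unfolding eq total_on_def using tot by blast
  moreover have "glued_order rep L \<subseteq> X \<times> X"
    unfolding eq by auto
  ultimately show ?thesis by (simp add: order_on_defs)
qed

end

text \<open>
  Every glued order answers on \<open>(x, y)\<close> what the order of the meet \<open>s\<close> answers on the two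
  representatives. The local decoding function for the instance \<open>(j, s)\<close>
  then returns the value of the query at the representatives, which is the value at \<open>(x, y)\<close> by
  invariance. A single decoding function serves all \<open>s\<close>, so \<open>s\<close> itself need not be recovered.
\<close>

lemma decodable_glue:
  assumes hierarchy: "\<And>j. j \<in> J \<Longrightarrow> hierarchy (X j) (C j)"
    and W: "\<And>j. j \<in> J \<Longrightarrow> W j \<subseteq> X j \<times> X j - Id"
    and rep: "\<And>j c. j \<in> J \<Longrightarrow> c \<in> C j \<Longrightarrow> rep j c \<in> c"
    and invariant: "\<And>j x y p q. j \<in> J \<Longrightarrow> (x, y) \<in> W j \<Longrightarrow>
      p = rep j (side (C j) x y) \<Longrightarrow> q = rep j (side (C j) y x) \<Longrightarrow>
      (p, q) \<in> W j \<and> Q j p q = Q j x y"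
    and local: "decodable (Sigma J C) (\<lambda>(j, s). X j)
      (\<lambda>(j, s). {(x, y) \<in> W j. meet (C j) x y = s}) (\<lambda>(j, s). Q j)"
  shows "decodable J X W Q"
proof -
  obtain b L dec where dec: "decodes (Sigma J C) (\<lambda>(j, s). X j)
      (\<lambda>(j, s). {(x, y) \<in> W j. meet (C j) x y = s}) (\<lambda>(j, s). Q j) b L dec"
    by (rule decodableE[OF local])
  show ?thesis
  proof (rule decodableI[where b = b and dec = dec
        and L = "\<lambda>j i. glued_order (X j) (C j) (rep j) (\<lambda>s. L (j, s) i)"])
    fix j i assume "j \<in> J" "i < b"
    then show "linear_order_on (X j) (glued_order (X j) (C j) (rep j) (\<lambda>s. L (j, s) i))"
      using hierarchy rep dec
      by (intro linear_order_on_glued_order) (auto simp: decodes_def)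
  next
    fix j x y assume *: "j \<in> J" "(x, y) \<in> W j"
    then have xy: "x \<in> X j" "y \<in> X j" "x \<noteq> y" using W by auto
    note C = hierarchy[OF *(1)]
    define p q s where "p = rep j (side (C j) x y)" and "q = rep j (side (C j) y x)"
      and "s = meet (C j) x y"
    have pq: "(p, q) \<in> W j" "Q j p q = Q j x y"
      using invariant[OF * p_def q_def] by auto
    have "meet (C j) p q = s"
      unfolding s_def
      by (rule meet_replace[OF hierarchy_laminar[OF C] subset_refl
            hierarchy_side(1)[OF C xy] hierarchy_side(1)[OF C xy(2,1)] hierarchy_side_disjoint[OF C xy]])
         (use xy rep[OF *(1)] hierarchy_side[OF C] in \<open>auto simp: p_def q_def\<close>)
    moreover have "s \<in> C j" using hierarchy_meet_mem[OF C] xy by (simp add: s_def)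
    ultimately have "Q j p q = dec (order_bits b (L (j, s)) p q)"
      using dec * pq unfolding decodes_def by (auto simp: Ball_def)
    moreover have "order_bits b (\<lambda>i. glued_order (X j) (C j) (rep j) (\<lambda>s. L (j, s) i)) x y =
        order_bits b (L (j, s)) p q"
      using xy by (simp add: order_bits_def glued_order_def[OF C] p_def q_def s_def)
    ultimately show "Q j x y =
        dec (order_bits b (\<lambda>i. glued_order (X j) (C j) (rep j) (\<lambda>s. L (j, s) i)) x y)"
      using pq by simp
  qed
qed

text \<open>
  Within the pairs having a fixed meet, a predicate of the meet is a property of the instance, to which
  \<open>decodable_index_property\<close> applies; gluing does the rest.
\<close>

lemma decodable_meet_predicate:
  fixes P :: "'j \<Rightarrow> 'a set \<Rightarrow> bool"
  assumes F: "\<And>j. j \<in> J \<Longrightarrow> laminar (X j) (F j)"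
    and W: "\<And>j x y. j \<in> J \<Longrightarrow> (x, y) \<in> W j \<Longrightarrow> x \<noteq> y \<and> (\<exists>t\<in>F j. x \<in> t \<and> y \<in> t)"
  shows "decodable J X W (\<lambda>j x y. P j (meet (F j) x y))"
proof -
  let ?C = "\<lambda>j. completion (X j) (F j)" and ?V = "\<lambda>j. X j \<times> X j - Id"
    and ?rep = "\<lambda>j c. SOME x. x \<in> c"
  have C: "hierarchy (X j) (?C j)" if "j \<in> J" for j
    using hierarchy_completion[OF F[OF that]] .
  have rep: "?rep j c \<in> c" if "j \<in> J" "c \<in> ?C j" for j c
    using hierarchy_laminar[OF C[OF that(1)]] that(2) by (auto simp: laminar_def some_in_eq)
  have "decodable J X ?V (\<lambda>j x y. P j (meet (?C j) x y))"
  proof (rule decodable_glue[OF C _ rep])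
    fix j x y p q
    assume j: "j \<in> J" and xy: "(x, y) \<in> ?V j"
      and p: "p = ?rep j (side (?C j) x y)" and q: "q = ?rep j (side (?C j) y x)"
    note side = hierarchy_side[OF C[OF j]]
    have xy: "x \<in> X j" "y \<in> X j" "x \<noteq> y" using xy by auto
    have pq: "p \<in> side (?C j) x y" "q \<in> side (?C j) y x"
      unfolding p q using rep[OF j] side(1) xy by auto
    have sub: "side (?C j) x y \<subseteq> X j" "side (?C j) y x \<subseteq> X j"
      using side(1) xy hierarchy_laminar[OF C[OF j]] by (auto simp: laminar_def)
    have disj: "side (?C j) x y \<inter> side (?C j) y x = {}"
      by (rule hierarchy_side_disjoint[OF C[OF j] xy])
    have "meet (?C j) p q = meet (?C j) x y"
      by (rule meet_replace[OF hierarchy_laminar[OF C[OF j]] subset_refl side(1) side(1) disj])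
         (use xy pq side in auto)
    then show "(p, q) \<in> ?V j \<and> P j (meet (?C j) p q) = P j (meet (?C j) x y)"
      using pq sub disj by auto
  next
    show "decodable (Sigma J ?C) (\<lambda>(j, s). X j) (\<lambda>(j, s). {(x, y) \<in> ?V j. meet (?C j) x y = s})
      (\<lambda>(j, s) x y. P j (meet (?C j) x y))"
      by (rule decodable_subset[OF decodable_index_property[where P = "\<lambda>(j, s). P j s"]])
         (use F in \<open>auto simp: laminar_def\<close>)
  qed auto
  then show ?thesis
  proof (rule decodable_subset)
    fix j x y assume *: "j \<in> J" "(x, y) \<in> W j"
    then show "P j (meet (F j) x y) = P j (meet (?C j) x y)"
      using W[OF *] meet_completion[OF F[OF *(1)]] by auto
    show "(x, y) \<in> ?V j"
      using W[OF *] F[OF *(1)] by (auto simp: laminar_def)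
  qed
qed

lemma decodable_meet_value:
  assumes "\<And>j. j \<in> J \<Longrightarrow> laminar (X j) (F j)"
    and "\<And>j x y. j \<in> J \<Longrightarrow> (x, y) \<in> W j \<Longrightarrow> x \<noteq> y \<and> (\<exists>t\<in>F j. x \<in> t \<and> y \<in> t)"
    and "finite V" "\<And>j x y. j \<in> J \<Longrightarrow> (x, y) \<in> W j \<Longrightarrow> f j (meet (F j) x y) \<in> V"
  shows "decodable J X W (\<lambda>j x y. f j (meet (F j) x y))"
  by (rule decodable_finite_valued[of V])
     (use assms decodable_meet_predicate[of J X F W] in auto)


section \<open>Labels at the meet\<close>

text \<open>
  Only the labels of tracked points matter. Restricting to the points with a given label in a cut
  thus reduces the number of labels without renaming them or changing the meets.
\<close>

record 'a labelling =
  points :: "'a set"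
  family :: "'a set set"
  tracked :: "'a set"
  label :: "'a set \<Rightarrow> 'a \<Rightarrow> nat"

definition constant_on :: "'a labelling \<Rightarrow> 'a set \<Rightarrow> 'a set \<Rightarrow> bool" where
  "constant_on j s t \<longleftrightarrow> (\<forall>x\<in>t \<inter> tracked j. \<forall>y\<in>t \<inter> tracked j. label j s x = label j s y)"

text \<open>
  Coherence says that points with equal labels keep equal labels in larger members, as under
  relabelling. The bound \<open>w\<close> on the labels stays fixed in the induction; the number \<open>k\<close> of labels that
  occur in one member is what decreases.
\<close>

definition coherent :: "nat \<Rightarrow> nat \<Rightarrow> 'a labelling \<Rightarrow> bool" where
  "coherent w k j \<longleftrightarrow> laminar (points j) (family j) \<and>
     (\<forall>t\<in>family j. \<forall>x\<in>t \<inter> tracked j. label j t x < w) \<and>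
     (\<forall>s\<in>family j. \<forall>t\<in>family j. s \<subseteq> t \<longrightarrow> (\<forall>x\<in>s \<inter> tracked j. \<forall>y\<in>s \<inter> tracked j.
        label j s x = label j s y \<longrightarrow> label j t x = label j t y)) \<and>
     (\<forall>t\<in>family j. card (label j t ` (t \<inter> tracked j)) \<le> k)"

definition covered_pairs :: "'a labelling \<Rightarrow> 'a rel" where
  "covered_pairs j = {(x, y). x \<noteq> y \<and> x \<in> tracked j \<and> (\<exists>t\<in>family j. x \<in> t \<and> y \<in> t)}"

definition label_at_meet :: "'a labelling \<Rightarrow> 'a \<Rightarrow> 'a \<Rightarrow> nat" where
  "label_at_meet j x y = label j (meet (family j) x y) x"

lemma coherentD:
  assumes "coherent w k j"
  shows "laminar (points j) (family j)"
    and "t \<in> family j \<Longrightarrow> x \<in> t \<Longrightarrow> x \<in> tracked j \<Longrightarrow> label j t x < w"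
    and "s \<in> family j \<Longrightarrow> t \<in> family j \<Longrightarrow> s \<subseteq> t \<Longrightarrow> x \<in> s \<Longrightarrow> x \<in> tracked j \<Longrightarrow>
      y \<in> s \<Longrightarrow> y \<in> tracked j \<Longrightarrow> label j s x = label j s y \<Longrightarrow> label j t x = label j t y"
    and "t \<in> family j \<Longrightarrow> card (label j t ` (t \<inter> tracked j)) \<le> k"
proof -
  note * = assms[unfolded coherent_def]
  show "laminar (points j) (family j)" using * by (rule conjunct1)
  show "label j t x < w" if "t \<in> family j" "x \<in> t" "x \<in> tracked j"
    using bspec[OF bspec[OF conjunct1[OF conjunct2[OF *]] that(1)] IntI[OF that(2,3)]] .
  show "card (label j t ` (t \<inter> tracked j)) \<le> k" if "t \<in> family j"
    using bspec[OF conjunct2[OF conjunct2[OF conjunct2[OF *]]] that] .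
  show "label j t x = label j t y" if "s \<in> family j" "t \<in> family j" "s \<subseteq> t"
    "x \<in> s" "x \<in> tracked j" "y \<in> s" "y \<in> tracked j" "label j s x = label j s y"
    using mp[OF bspec[OF bspec[OF mp[OF bspec[OF bspec[OF
      conjunct1[OF conjunct2[OF conjunct2[OF *]]] that(1)] that(2)] that(3)]
      IntI[OF that(4,5)]] IntI[OF that(6,7)]] that(8)] .
qed

lemma coherent_constant_on_mono:
  assumes "coherent w k j" "s \<in> family j" "t \<in> family j" "u \<subseteq> s" "s \<subseteq> t" "constant_on j s u"
  shows "constant_on j t u"
  unfolding constant_on_def
proof (intro ballI)
  fix x y assume xy: "x \<in> u \<inter> tracked j" "y \<in> u \<inter> tracked j"
  then have "label j s x = label j s y" using assms(6) unfolding constant_on_def by blast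
  then show "label j t x = label j t y"
    using coherentD(3)[OF assms(1-3,5)] assms(4) xy by (meson IntD1 IntD2 subsetD)
qed

text \<open>
  The membership of \<open>t\<close> in \<open>C\<close> depends on larger sets only, so the equivalence is a recursive
  definition of \<open>C\<close> from the largest sets downwards.
\<close>

lemma ex_greedy_subfamily:
  assumes "finite F"
  shows "\<exists>C\<subseteq>F. \<forall>t\<in>F. t \<in> C \<longleftrightarrow> (\<forall>s\<in>C. t \<subset> s \<longrightarrow> R s t)"
  using assms
proof (induction "card F" arbitrary: F)
  case 0
  then show ?case by auto
next
  case (Suc n)
  then have "F \<noteq> {}" by auto
  then obtain m where m: "m \<in> F" "\<And>t. t \<in> F \<Longrightarrow> \<not> t \<subset> m"
    using finite_has_minimal[OF Suc.prems] by (metis psubsetE)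
  have "n = card (F - {m})" "finite (F - {m})"
    using Suc.hyps(2) Suc.prems m(1) by auto
  from Suc.hyps(1)[OF this] obtain C
    where C: "C \<subseteq> F - {m}" "\<forall>t\<in>F - {m}. t \<in> C \<longleftrightarrow> (\<forall>s\<in>C. t \<subset> s \<longrightarrow> R s t)" by blast
  show ?case
  proof (cases "\<forall>s\<in>C. m \<subset> s \<longrightarrow> R s m")
    case True
    then show ?thesis using C m by (intro exI[of _ "insert m C"]) auto
  next
    case False
    then show ?thesis using C m by (intro exI[of _ C]) auto
  qed
qed

definition cuts :: "'a labelling \<Rightarrow> 'a set set" where
  "cuts j = (SOME C. C \<subseteq> family j \<and>
     (\<forall>t\<in>family j. t \<in> C \<longleftrightarrow> (\<forall>s\<in>C. t \<subset> s \<longrightarrow> constant_on j s t)))"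

text \<open>
  The parity of the depth of a cut. It is also defined for other members of the family, for which
  it is the parity of the smallest cut above.
\<close>

definition cut_parity :: "'a labelling \<Rightarrow> 'a set \<Rightarrow> bool" where
  "cut_parity j t \<longleftrightarrow> even (card {c \<in> cuts j. t \<subseteq> c})"

definition cut_hierarchy :: "'a labelling \<Rightarrow> bool \<Rightarrow> 'a set set" where
  "cut_hierarchy j p = completion (points j) {c \<in> cuts j. cut_parity j c = p}"

lemma cuts_spec:
  assumes "coherent w k j"
  shows "cuts j \<subseteq> family j"
    and "t \<in> family j \<Longrightarrow> t \<in> cuts j \<longleftrightarrow> (\<forall>s\<in>cuts j. t \<subset> s \<longrightarrow> constant_on j s t)"
proof -
  have "finite (family j)" using laminar_finite coherentD(1)[OF assms] by blast
  from someI_ex[OF ex_greedy_subfamily[OF this, of "constant_on j"]]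
  have *: "cuts j \<subseteq> family j \<and>
    (\<forall>t\<in>family j. t \<in> cuts j \<longleftrightarrow> (\<forall>s\<in>cuts j. t \<subset> s \<longrightarrow> constant_on j s t))"
    unfolding cuts_def .
  then show "cuts j \<subseteq> family j" ..
  show "t \<in> cuts j \<longleftrightarrow> (\<forall>s\<in>cuts j. t \<subset> s \<longrightarrow> constant_on j s t)" if "t \<in> family j"
    using conjunct2[OF *] that by (rule bspec)
qed

lemma hierarchy_cut_hierarchy:
  assumes "coherent w k j"
  shows "hierarchy (points j) (cut_hierarchy j p)"
  unfolding cut_hierarchy_def
  by (rule hierarchy_completion[OF laminar_subset[OF coherentD(1)[OF assms]]])
     (rule subset_trans[OF Collect_subset cuts_spec(1)[OF assms]])

text \<open>
  The pairs for which the label of \<open>x\<close> is not already determined by the meet, split by parity so that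
  each class can be glued along the cuts of its parity.
\<close>

definition varying_pairs :: "bool \<Rightarrow> 'a labelling \<Rightarrow> 'a rel" where
  "varying_pairs p j = {(x, y) \<in> covered_pairs j. let m = meet (family j) x y in
     \<not> constant_on j m m \<and> cut_parity j m = p}"

context
  fixes w k :: nat and j :: "'a labelling" and x y :: 'a and p :: bool and m s :: "'a set"
  assumes coherent: "coherent w k j" and xy: "(x, y) \<in> varying_pairs p j"
  defines "m \<equiv> meet (family j) x y" and "s \<equiv> meet (cut_hierarchy j p) x y"
begin

lemma varying_pair:
  shows "x \<noteq> y" "x \<in> tracked j" "x \<in> m" "y \<in> m" "m \<in> family j" "m \<subseteq> points j"
    "\<not> constant_on j m m" "cut_parity j m = p"
proof -
  have lam: "laminar (points j) (family j)" using coherentD(1)[OF coherent] .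
  show "x \<noteq> y" "x \<in> tracked j" "\<not> constant_on j m m" "cut_parity j m = p"
    using xy by (auto simp: varying_pairs_def covered_pairs_def Let_def m_def)
  show "x \<in> m" "y \<in> m" by (auto simp: m_def meet_left meet_right)
  show m: "m \<in> family j"
    using xy meet_mem[OF lam] by (auto simp: varying_pairs_def covered_pairs_def m_def)
  then show "m \<subseteq> points j" using lam by (auto simp: laminar_def)
qed

text \<open>
  The meet in the hierarchy of cuts of the right parity is the smallest cut \<open>s\<close> above the meet \<open>m\<close> in
  the family. If \<open>m\<close> is a cut, then \<open>s = m\<close>; otherwise some larger cut is not constant on \<open>m\<close>, and by
  coherence the smallest one is not constant on \<open>m\<close> either.
\<close>

lemma varying_pair_block:
  shows "s \<in> cuts j" "cut_parity j s = p" "m \<subseteq> s" "\<not> constant_on j s m"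
    and "\<And>c. c \<in> cuts j \<Longrightarrow> x \<in> c \<Longrightarrow> y \<in> c \<Longrightarrow> s \<subseteq> c"
proof -
  note m = varying_pair
  note cuts = cuts_spec[OF coherent]
  have lam: "laminar (points j) (family j)" using coherentD(1)[OF coherent] .
  have lamC: "laminar (points j) (cuts j)" using laminar_subset[OF lam cuts(1)] .
  define u where "u = meet (cuts j) x y"
  have le: "m \<subseteq> c \<longleftrightarrow> u \<subseteq> c" "x \<in> c \<and> y \<in> c \<longleftrightarrow> u \<subseteq> c" if "c \<in> cuts j" for c
    using that cuts(1) meet_least[of c "cuts j" x y] meet_least[of c "family j" x y]
      meet_left[of x "cuts j" y] meet_right[of y "cuts j" x] m(3,4)
    by (auto simp: u_def m_def)
  obtain r where r: "r \<in> cuts j" "m \<subseteq> r" "\<not> constant_on j r m"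
    using cuts(2)[OF m(5)] m(7) by blast
  have u: "u \<in> cuts j"
    using meet_mem[OF lamC r(1), of x y] r(2) m(3,4) by (auto simp: u_def)
  have mu: "m \<subseteq> u" using le(1)[OF u] by simp
  have par: "cut_parity j u = p"
    using m(8) le(1) unfolding cut_parity_def by (metis (mono_tags, lifting) Collect_cong)
  have su: "s = u"
  proof
    show "s \<subseteq> u"
      unfolding s_def cut_hierarchy_def
      by (rule meet_least) (use u par mu m(3,4) in \<open>auto simp: completion_def\<close>)
    have "u \<subseteq> points j" using lamC u by (auto simp: laminar_def)
    then show "u \<subseteq> s"
      using m(1) le(2) unfolding s_def meet_def cut_hierarchy_def completion_def by blast
  qed
  show "s \<in> cuts j" "cut_parity j s = p" "m \<subseteq> s"
    "\<And>c. c \<in> cuts j \<Longrightarrow> x \<in> c \<Longrightarrow> y \<in> c \<Longrightarrow> s \<subseteq> c"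
    using u par mu le(2) by (auto simp: su)
  show "\<not> constant_on j s m"
  proof
    assume "constant_on j s m"
    moreover have "u \<subseteq> r" using le(1)[OF r(1)] r(2) by simp
    ultimately have "constant_on j r m"
      using u cuts(1) r(1) mu by (intro coherent_constant_on_mono[OF coherent, of u r m]) (auto simp: su)
    with r(3) show False ..
  qed
qed

text \<open>
  This is where the parity pays off. A cut \<open>c\<close> strictly below \<open>s\<close> with the same parity has another cut
  \<open>e\<close> strictly between, and \<open>e\<close> lies below the meet \<open>m\<close> because \<open>s\<close> is the smallest cut containing
  both points. The labels in \<open>e\<close> are constant on \<open>c\<close>, hence so are those in \<open>m\<close>.
\<close>

lemma varying_pair_side_constant:
  assumes c: "c = side (cut_hierarchy j p) x y"
  shows "constant_on j m c"
proof -
  note m = varying_pair and s = varying_pair_block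
  note cuts = cuts_spec[OF coherent] and H = hierarchy_cut_hierarchy[OF coherent, of p]
  have lam: "laminar (points j) (family j)" using coherentD(1)[OF coherent] .
  have X: "x \<in> points j" "y \<in> points j" using m(3,4,6) by auto
  have c': "c \<in> cut_hierarchy j p" "x \<in> c" "y \<notin> c"
    using hierarchy_side[OF H X m(1)] by (auto simp: c)
  then consider "c = {x}" | "c \<in> cuts j" "cut_parity j c = p"
    using m by (auto simp: cut_hierarchy_def completion_def)
  then show ?thesis
  proof cases
    case 1
    then show ?thesis by (auto simp: constant_on_def)
  next
    case 2
    have "c \<subseteq> s \<or> s \<subseteq> c" "y \<in> s"
      using laminar_comparable[OF lam, of c s x] cuts(1) 2(1) s(1,3) c'(2) m(3,4) by blast+
    with c'(3) have cs: "c \<subset> s" by blast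
    have fin: "finite {d \<in> cuts j. s \<subseteq> d}"
      using laminar_finite[OF lam] finite_subset[OF cuts(1)] by simp
    have "\<exists>e\<in>cuts j. c \<subset> e \<and> e \<subset> s"
    proof (rule ccontr)
      assume none: "\<not> ?thesis"
      have "s \<subseteq> d" if "d \<in> cuts j" "c \<subset> d" for d
        using laminar_comparable[OF lam, of d s x] cuts(1) s(1,3) c'(2) m(3) that none
        by blast
      then have "{d \<in> cuts j. c \<subseteq> d} = insert c {d \<in> cuts j. s \<subseteq> d}"
        using cs 2(1) by blast
      moreover have "c \<notin> {d \<in> cuts j. s \<subseteq> d}" using cs by blast
      ultimately have "card {d \<in> cuts j. c \<subseteq> d} = Suc (card {d \<in> cuts j. s \<subseteq> d})"
        using fin by simp
      then have "cut_parity j c \<noteq> cut_parity j s" by (simp add: cut_parity_def)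
      then show False using 2 s by simp
    qed
    then obtain e where e: "e \<in> cuts j" "c \<subset> e" "e \<subset> s" by blast
    have "y \<notin> e" using s(5)[OF e(1)] e(2,3) c'(2) by blast
    then have em: "e \<subseteq> m"
      using laminar_comparable[OF lam, of e m x] cuts(1) e c'(2) m by blast
    have "constant_on j e c" using cuts(1) cuts(2)[of c] 2(1) e(1,2) by blast
    then show ?thesis
      using coherent_constant_on_mono[OF coherent, of e m c] cuts(1) e m em by blast
  qed
qed

end

lemma covered_pairs_subset:
  assumes "coherent w k j"
  shows "covered_pairs j \<subseteq> points j \<times> points j - Id"
  using laminarD(3)[OF coherentD(1)[OF assms]] by (auto simp: covered_pairs_def)

text \<open>
  The condition \<open>s \<in> family j\<close> empties the family for the additional sets \<open>s\<close> of the hierarchy, so that the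
  result is coherent for every \<open>s\<close>.
\<close>

definition block_labelling :: "'a labelling \<Rightarrow> 'a set \<Rightarrow> nat \<Rightarrow> 'a labelling" where
  "block_labelling j s i =
     j\<lparr>family := {t \<in> family j. s \<in> family j \<and> t \<subseteq> s \<and> \<not> constant_on j s t},
       tracked := {x \<in> tracked j. label j s x = i}\<rparr>"

text \<open>
  As the labels in \<open>s\<close> vary on \<open>t\<close>, some point of \<open>t\<close> has a label other than \<open>i\<close> in \<open>s\<close>. By coherence its label
  in \<open>t\<close> is not shared by any point with label \<open>i\<close> in \<open>s\<close>, so at least one label is saved.
\<close>

lemma coherent_block_labelling:
  assumes "coherent w (Suc k) j"
  shows "coherent w k (block_labelling j s i)"
  unfolding coherent_def
proof (intro conjI ballI impI)
  note c = coherentD[OF assms]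
  let ?F = "{t \<in> family j. s \<in> family j \<and> t \<subseteq> s \<and> \<not> constant_on j s t}"
    and ?D = "{x \<in> tracked j. label j s x = i}"
  have sel [simp]: "family (block_labelling j s i) = ?F" "tracked (block_labelling j s i) = ?D"
    "label (block_labelling j s i) = label j" "points (block_labelling j s i) = points j"
    by (simp_all add: block_labelling_def)
  show "laminar (points (block_labelling j s i)) (family (block_labelling j s i))"
    unfolding sel by (rule laminar_subset[OF c(1) Collect_subset])
  show "label (block_labelling j s i) t x < w"
    if "t \<in> family (block_labelling j s i)" "x \<in> t \<inter> tracked (block_labelling j s i)" for t x
    using that c(2)[of t x] by simp
  show "label (block_labelling j s i) t x = label (block_labelling j s i) t y"
    if "u \<in> family (block_labelling j s i)" "t \<in> family (block_labelling j s i)" "u \<subseteq> t"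
      "x \<in> u \<inter> tracked (block_labelling j s i)" "y \<in> u \<inter> tracked (block_labelling j s i)"
      "label (block_labelling j s i) u x = label (block_labelling j s i) u y" for u t x y
    using that c(3)[of u t x y] by simp
  show "card (label (block_labelling j s i) t ` (t \<inter> tracked (block_labelling j s i))) \<le> k"
    if "t \<in> family (block_labelling j s i)" for t
  proof -
    have t: "t \<in> family j" "s \<in> family j" "t \<subseteq> s" "\<not> constant_on j s t"
      using that by simp_all
    then obtain z where z: "z \<in> t" "z \<in> tracked j" "label j s z \<noteq> i"
      unfolding constant_on_def by blast
    have "label j t z \<notin> label j t ` (t \<inter> ?D)"
    proof
      assume "label j t z \<in> label j t ` (t \<inter> ?D)"
      then obtain x where x: "x \<in> t" "x \<in> tracked j" "label j s x = i" "label j t z = label j t x"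
        by blast
      from c(3)[OF t(1-3) z(1,2) x(1,2,4)] x(3) z(3) show False by simp
    qed
    then have "label j t ` (t \<inter> ?D) \<subset> label j t ` (t \<inter> tracked j)"
      using z by blast
    moreover have "finite (label j t ` (t \<inter> tracked j))"
      using laminarD(1,3)[OF c(1)] t(1) by (meson finite_Int finite_imageI finite_subset)
    ultimately have "card (label j t ` (t \<inter> ?D)) < card (label j t ` (t \<inter> tracked j))"
      by (intro psubset_card_mono)
    with c(4)[OF t(1)] show ?thesis by simp
  qed
qed

lemma meet_subfamily: "G \<subseteq> F \<Longrightarrow> meet F x y \<in> G \<Longrightarrow> meet G x y = meet F x y"
  by (rule subset_antisym) (auto simp: meet_def)

text \<open>
  Once the cut \<open>s\<close> is fixed, the label of \<open>x\<close> in \<open>s\<close> is a function of \<open>x\<close>, and fixing its value leads to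
  a labelling with fewer labels.
\<close>

lemma decodable_within_blocks:
  assumes IH: "decodable {j :: 'a labelling. coherent w k j} points covered_pairs label_at_meet"
  defines "J \<equiv> {j :: 'a labelling. coherent w (Suc k) j}"
  shows "decodable (Sigma J (\<lambda>j. cut_hierarchy j p)) (\<lambda>(j, s). points j)
    (\<lambda>(j, s). {(x, y) \<in> varying_pairs p j. meet (cut_hierarchy j p) x y = s})
    (\<lambda>(j, s). label_at_meet j)"
    (is "decodable ?I ?X ?W ?Q")
proof (rule decodable_cases[where V = "{..<w}" and C = "\<lambda>(j, s) x y. label j s x"])
  have sub: "varying_pairs p j \<subseteq> points j \<times> points j - Id" if "coherent w (Suc k) j" for j
    using covered_pairs_subset[OF that] by (auto simp: varying_pairs_def)
  show "(case a of (j, s) \<Rightarrow> \<lambda>x y. label j s x) x y \<in> {..<w}"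
    if a: "a \<in> ?I" and xy: "(x, y) \<in> ?W a" for a x y
  proof -
    obtain j s where js: "a = (j, s)" by (cases a)
    have j: "coherent w (Suc k) j" using a by (simp add: js J_def)
    have xy: "(x, y) \<in> varying_pairs p j" and s: "s = meet (cut_hierarchy j p) x y"
      using xy by (simp_all add: js)
    show ?thesis
      using coherentD(2)[OF j, of s x] varying_pair_block(1,3)[OF j xy] varying_pair(2,3)[OF j xy]
        cuts_spec(1)[OF j] by (auto simp: js s)
  qed
  fix i assume "i \<in> {..<w}"
  have "decodable ?I ?X ?W (\<lambda>a x y. (case a of (j, s) \<Rightarrow> \<lambda>x. label j s x = i) x)"
    by (rule decodable_left_predicate)
       (use laminarD(1)[OF coherentD(1)] sub in \<open>fastforce simp: J_def\<close>)+
  then show "decodable ?I ?X ?W (\<lambda>a x y. (case a of (j, s) \<Rightarrow> \<lambda>x y. label j s x) x y = i)"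
    by (rule decodable_subset) auto
  show "decodable ?I ?X
    (\<lambda>a. {(x, y) \<in> ?W a. (case a of (j, s) \<Rightarrow> \<lambda>x y. label j s x) x y = i}) ?Q"
  proof (rule decodable_mono[OF IH, where g = "\<lambda>(j, s). block_labelling j s i"])
    fix a assume a: "a \<in> ?I"
    obtain j s where js: "a = (j, s)" by (cases a)
    have j: "coherent w (Suc k) j" using a by (simp add: js J_def)
    then show "(case a of (j, s) \<Rightarrow> block_labelling j s i) \<in> {j. coherent w k j}"
      by (simp add: js coherent_block_labelling)
    show "?X a = points (case a of (j, s) \<Rightarrow> block_labelling j s i)"
      by (simp add: js block_labelling_def)
    fix x y assume "(x, y) \<in> {(x, y) \<in> ?W a. (case a of (j, s) \<Rightarrow> \<lambda>x y. label j s x) x y = i}"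
    then have xy: "(x, y) \<in> varying_pairs p j" and s: "s = meet (cut_hierarchy j p) x y"
      and i: "label j s x = i"
      by (simp_all add: js)
    let ?B = "block_labelling j s i"
    let ?m = "meet (family j) x y"
    note m = varying_pair[OF j xy] and b = varying_pair_block[OF j xy, folded s]
    have mB: "?m \<in> family ?B"
      using m(5) b(1,3,4) cuts_spec(1)[OF j] by (auto simp: block_labelling_def)
    have "meet (family ?B) x y = ?m"
      by (rule meet_subfamily[OF _ mB]) (auto simp: block_labelling_def)
    then show "?Q a x y = label_at_meet (case a of (j, s) \<Rightarrow> block_labelling j s i) x y"
      by (simp add: js label_at_meet_def block_labelling_def)
    have "x \<in> tracked ?B" using m(2) i by (simp add: block_labelling_def)
    then show "(x, y) \<in> covered_pairs (case a of (j, s) \<Rightarrow> block_labelling j s i)"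
      using m(1,3,4) mB by (auto simp: js covered_pairs_def)
  qed
qed simp

text \<open>
  The blocks are glued along the cuts of one parity. Representatives have to be tracked whenever
  possible, because constancy of labels is only known for tracked points.
\<close>

lemma decodable_varying_pairs:
  assumes IH: "decodable {j :: 'a labelling. coherent w k j} points covered_pairs label_at_meet"
  shows "decodable {j :: 'a labelling. coherent w (Suc k) j} points (varying_pairs p) label_at_meet"
proof -
  let ?J = "{j :: 'a labelling. coherent w (Suc k) j}"
  define rep where "rep j c = (SOME x. x \<in> c \<and> (c \<inter> tracked j \<noteq> {} \<longrightarrow> x \<in> tracked j))"
    for j :: "'a labelling" and c
  have rep: "rep j c \<in> c" "c \<inter> tracked j \<noteq> {} \<Longrightarrow> rep j c \<in> tracked j" if "c \<noteq> {}" for j c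
  proof -
    have "\<exists>x. x \<in> c \<and> (c \<inter> tracked j \<noteq> {} \<longrightarrow> x \<in> tracked j)" using that by blast
    from someI_ex[OF this] show "rep j c \<in> c" "c \<inter> tracked j \<noteq> {} \<Longrightarrow> rep j c \<in> tracked j"
      unfolding rep_def by blast+
  qed
  show ?thesis
  proof (rule decodable_glue[where C = "\<lambda>j. cut_hierarchy j p" and rep = rep])
    fix j assume "j \<in> ?J"
    then have j: "coherent w (Suc k) j" by simp
    note lam = coherentD(1)[OF j]
    show H: "hierarchy (points j) (cut_hierarchy j p)"
      by (rule hierarchy_cut_hierarchy[OF j])
    show "varying_pairs p j \<subseteq> points j \<times> points j - Id"
      using covered_pairs_subset[OF j] by (auto simp: varying_pairs_def)
    show repH: "rep j c \<in> c" if "c \<in> cut_hierarchy j p" for c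
      using rep(1) laminarD(2)[OF hierarchy_laminar[OF H] that] .
    fix x y u v
    assume xy: "(x, y) \<in> varying_pairs p j" and u: "u = rep j (side (cut_hierarchy j p) x y)"
      and v: "v = rep j (side (cut_hierarchy j p) y x)"
    let ?m = "meet (family j) x y"
    let ?c = "side (cut_hierarchy j p) x y" and ?d = "side (cut_hierarchy j p) y x"
    note m = varying_pair[OF j xy]
    have X: "x \<in> points j" "y \<in> points j" using m(3,4,6) by auto
    note c = hierarchy_side[OF H X m(1)] and d = hierarchy_side[OF H X(2,1) m(1)[symmetric]]
    note disj = hierarchy_side_disjoint[OF H X m(1)]
    have uc: "u \<in> ?c" and vd: "v \<in> ?d" using repH c(1) d(1) by (auto simp: u v)
    have ut: "u \<in> tracked j" unfolding u using c(2) m(2) by (intro rep(2)) auto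
    have "cut_hierarchy j p \<subseteq> completion (points j) (family j)"
      using cuts_spec(1)[OF j] by (auto simp: cut_hierarchy_def completion_def)
    then have cd: "?c \<in> completion (points j) (family j)" "?d \<in> completion (points j) (family j)"
      using c(1) d(1) by auto
    have meet: "?m = meet (family j) u v"
      by (rule meet_replace[OF hierarchy_laminar[OF hierarchy_completion[OF lam]] _ cd disj
            c(2) uc d(2) vd]) (auto simp: completion_def)
    have "u \<noteq> v" using uc vd disj by auto
    moreover have "u \<in> ?m" "v \<in> ?m" unfolding meet by (auto simp: meet_left meet_right)
    ultimately have "(u, v) \<in> varying_pairs p j"
      using ut m(5,7,8) by (auto simp: varying_pairs_def covered_pairs_def Let_def meet[symmetric])
    moreover have "label j ?m u = label j ?m x"
      using varying_pair_side_constant[OF j xy refl] uc c(2) ut m(2)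
      unfolding constant_on_def by blast
    ultimately show "(u, v) \<in> varying_pairs p j \<and> label_at_meet j u v = label_at_meet j x y"
      by (simp add: label_at_meet_def meet[symmetric])
  qed (rule decodable_within_blocks[OF IH])
qed

lemma decodable_constant_meet:
  shows "decodable {j. coherent w k j} points
    (\<lambda>j. {(x, y) \<in> covered_pairs j. constant_on j (meet (family j) x y) (meet (family j) x y)})
    label_at_meet"
proof -
  define f where "f j t = label j t (SOME x. x \<in> t \<inter> tracked j)" for j :: "'a labelling" and t
  have f: "f j (meet (family j) x y) = label_at_meet j x y \<and> label_at_meet j x y < w"
    if j: "coherent w k j" and xy: "(x, y) \<in> covered_pairs j"
      and const: "constant_on j (meet (family j) x y) (meet (family j) x y)" for j x y
  proof -
    let ?m = "meet (family j) x y"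
    have x: "x \<in> ?m \<inter> tracked j"
      using xy meet_left[of x "family j" y] by (simp add: covered_pairs_def)
    then have "(SOME x. x \<in> ?m \<inter> tracked j) \<in> ?m \<inter> tracked j" by (rule someI)
    then have "f j ?m = label j ?m x" using x const unfolding f_def constant_on_def by blast
    moreover have "?m \<in> family j"
      using xy meet_mem[OF coherentD(1)[OF j]] by (auto simp: covered_pairs_def)
    ultimately show ?thesis
      using coherentD(2)[OF j _ IntD1[OF x] IntD2[OF x]] by (simp add: label_at_meet_def)
  qed
  have "decodable {j. coherent w k j} points
    (\<lambda>j. {(x, y) \<in> covered_pairs j. constant_on j (meet (family j) x y) (meet (family j) x y)})
    (\<lambda>j x y. f j (meet (family j) x y))"
    by (rule decodable_meet_value[where V = "{..<w}"])
       (use coherentD(1) f in \<open>auto simp: covered_pairs_def\<close>)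
  then show ?thesis by (rule decodable_subset) (use f in auto)
qed

lemma decodable_label_at_meet:
  "decodable {j. coherent w k j} points covered_pairs label_at_meet"
proof (induction k)
  case 0
  have False if j: "coherent w 0 j" and xy: "(x, y) \<in> covered_pairs j" for j :: "'a labelling" and x y
  proof -
    obtain t where t: "t \<in> family j" "x \<in> t \<inter> tracked j"
      using xy by (auto simp: covered_pairs_def)
    have "finite (t \<inter> tracked j)"
      using laminarD(1,3)[OF coherentD(1)[OF j]] t(1) by (meson finite_Int finite_subset)
    then have "card (label j t ` (t \<inter> tracked j)) > 0" using t(2) by (auto simp: card_gt_0_iff)
    with coherentD(4)[OF j t(1)] show False by simp
  qed
  then show ?case by (intro decodable_const) auto
next
  case (Suc k)
  let ?J = "{j :: 'a labelling. coherent w (Suc k) j}" and ?m = "\<lambda>j. meet (family j)"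
  have meet_query: "decodable ?J points W (\<lambda>j x y. P j (?m j x y))"
    if "\<And>j. W j \<subseteq> covered_pairs j" for W and P :: "'a labelling \<Rightarrow> 'a set \<Rightarrow> bool"
    using that coherentD(1)
    by (intro decodable_meet_predicate) (auto simp: covered_pairs_def)
  show ?case
  proof (rule decodable_if[where P = "\<lambda>j x y. constant_on j (?m j x y) (?m j x y)"])
    show "decodable ?J points covered_pairs (\<lambda>j x y. constant_on j (?m j x y) (?m j x y))"
      by (rule meet_query[of covered_pairs "\<lambda>j t. constant_on j t t"]) simp
    show "decodable ?J points
      (\<lambda>j. {(x, y) \<in> covered_pairs j. constant_on j (?m j x y) (?m j x y)}) label_at_meet"
      by (rule decodable_constant_meet)
    let ?W = "\<lambda>j. {(x, y) \<in> covered_pairs j. \<not> constant_on j (?m j x y) (?m j x y)}"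
    show "decodable ?J points ?W label_at_meet"
    proof (rule decodable_if[where P = "\<lambda>j x y. cut_parity j (?m j x y)"])
      show "decodable ?J points ?W (\<lambda>j x y. cut_parity j (?m j x y))"
        by (rule meet_query) auto
      show "decodable ?J points (\<lambda>j. {(x, y) \<in> ?W j. cut_parity j (?m j x y)}) label_at_meet"
        by (rule decodable_subset[OF decodable_varying_pairs[OF Suc, of True]])
           (auto simp: varying_pairs_def)
      show "decodable ?J points (\<lambda>j. {(x, y) \<in> ?W j. \<not> cut_parity j (?m j x y)}) label_at_meet"
        by (rule decodable_subset[OF decodable_varying_pairs[OF Suc, of False]])
           (auto simp: varying_pairs_def)
    qed
  qed
qed


section \<open>From constructions to labelled laminar families\<close>

lemma cw_construction_labels:
  "cw_construction w V E lab \<Longrightarrow> v \<in> V \<Longrightarrow> lab v \<in> {1..w}"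
  by (induction rule: cw_construction.induct) auto

lemma cw_construction_finite_nonempty:
  "cw_construction w V E lab \<Longrightarrow> finite V \<and> V \<noteq> {}"
  by (induction rule: cw_construction.induct) auto

definition represents ::
    "'a set set \<Rightarrow> ('a set \<Rightarrow> 'a \<Rightarrow> nat) \<Rightarrow> ('a set \<Rightarrow> nat rel) \<Rightarrow> 'a rel \<Rightarrow> 'a \<Rightarrow> 'a \<Rightarrow> bool" where
  "represents F l R E x y \<longleftrightarrow>
     (let m = meet F x y in (x, y) \<in> E \<longleftrightarrow> (l m x, l m y) \<in> R m)"

text \<open>
  The clause relating \<open>l\<close> to \<open>lab\<close> says that the current labels are determined by those in any member
  of the family. It is what lets the relations \<open>R\<close> absorb further arcs: adding all arcs from label \<open>i\<close> to label
  \<open>j\<close> enlarges \<open>R t\<close>, for every earlier union \<open>t\<close>, by those pairs of labels in \<open>t\<close> that have meanwhile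
  turned into \<open>i\<close> and \<open>j\<close>.
\<close>

lemma cw_construction_representation:
  assumes "cw_construction w V E lab"
  shows "\<exists>F l R. laminar V F \<and> V \<in> F \<and>
    (\<forall>t\<in>F. \<forall>x\<in>t. l t x \<le> w) \<and>
    (\<forall>s\<in>F. \<forall>t\<in>F. \<forall>x\<in>s. \<forall>y\<in>s. s \<subseteq> t \<longrightarrow> l s x = l s y \<longrightarrow> l t x = l t y) \<and>
    (\<forall>t\<in>F. \<forall>x\<in>t. \<forall>y\<in>t. l t x = l t y \<longrightarrow> lab x = lab y) \<and>
    (\<forall>x\<in>V. \<forall>y\<in>V. x \<noteq> y \<longrightarrow> represents F l R E x y)"
  using assms
proof (induction rule: cw_construction.induct)
  case (single lab v)
  then show ?case
    by (intro exI[of _ "{{v}}"] exI[of _ "\<lambda>_. lab"]) (auto simp: laminar_def)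
next
  case (disjoint_union V1 E1 lab1 V2 E2 lab2)
  let ?V = "V1 \<union> V2" and ?lab = "\<lambda>v. if v \<in> V1 then lab1 v else lab2 v"
  from disjoint_union.IH(1) obtain F1 l1 R1 where F1: "laminar V1 F1" "V1 \<in> F1"
    and le1: "\<forall>t\<in>F1. \<forall>x\<in>t. l1 t x \<le> w"
    and mono1: "\<forall>s\<in>F1. \<forall>t\<in>F1. \<forall>x\<in>s. \<forall>y\<in>s. s \<subseteq> t \<longrightarrow> l1 s x = l1 s y \<longrightarrow> l1 t x = l1 t y"
    and lab1: "\<forall>t\<in>F1. \<forall>x\<in>t. \<forall>y\<in>t. l1 t x = l1 t y \<longrightarrow> lab1 x = lab1 y"
    and rep1: "\<forall>x\<in>V1. \<forall>y\<in>V1. x \<noteq> y \<longrightarrow> represents F1 l1 R1 E1 x y"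
    by (elim exE conjE)
  from disjoint_union.IH(2) obtain F2 l2 R2 where F2: "laminar V2 F2" "V2 \<in> F2"
    and le2: "\<forall>t\<in>F2. \<forall>x\<in>t. l2 t x \<le> w"
    and mono2: "\<forall>s\<in>F2. \<forall>t\<in>F2. \<forall>x\<in>s. \<forall>y\<in>s. s \<subseteq> t \<longrightarrow> l2 s x = l2 s y \<longrightarrow> l2 t x = l2 t y"
    and lab2: "\<forall>t\<in>F2. \<forall>x\<in>t. \<forall>y\<in>t. l2 t x = l2 t y \<longrightarrow> lab2 x = lab2 y"
    and rep2: "\<forall>x\<in>V2. \<forall>y\<in>V2. x \<noteq> y \<longrightarrow> represents F2 l2 R2 E2 x y"
    by (elim exE conjE)
  note disj = disjoint_union.hyps(3)
  have arcs: "E1 \<subseteq> V1 \<times> V1" "E2 \<subseteq> V2 \<times> V2"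
    using disjoint_union.hyps(1,2) by (auto dest: cw_construction_arcs)
  have labV: "?lab v \<le> w" if "v \<in> ?V" for v
    using cw_construction_labels[OF disjoint_union.hyps(1), of v]
      cw_construction_labels[OF disjoint_union.hyps(2), of v] that by auto
  have fin: "finite ?V" and ne: "V1 \<noteq> {}" "V2 \<noteq> {}"
    using disjoint_union.hyps(1,2) by (auto dest: cw_construction_finite_nonempty)
  have sub1: "t \<subseteq> V1" "t \<noteq> {}" "t \<notin> F2" "t \<noteq> ?V" if "t \<in> F1" for t
    using laminarD(2,3)[OF F1(1) that] laminarD(3)[OF F2(1), of t] disj ne by auto
  have sub2: "t \<subseteq> V2" "t \<noteq> {}" "t \<notin> F1" "t \<noteq> ?V" if "t \<in> F2" for t
    using laminarD(2,3)[OF F2(1) that] laminarD(3)[OF F1(1), of t] disj ne by auto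
  define F where "F = insert ?V (F1 \<union> F2)"
  define l where "l t = (if t \<in> F1 then l1 t else if t \<in> F2 then l2 t else ?lab)" for t
  define R where "R t = (if t \<in> F1 then R1 t else if t \<in> F2 then R2 t else {})" for t
  have VF: "?V \<notin> F1" "?V \<notin> F2" using sub1(4) sub2(4) by auto
  have l: "t \<in> F1 \<Longrightarrow> l t = l1 t" "t \<in> F2 \<Longrightarrow> l t = l2 t" "l ?V = ?lab"
    and R: "t \<in> F1 \<Longrightarrow> R t = R1 t" "t \<in> F2 \<Longrightarrow> R t = R2 t" "R ?V = {}" for t
    using sub2(3)[of t] VF by (auto simp: l_def R_def)
  have Fcases: "t = ?V \<or> t \<in> F1 \<or> t \<in> F2" if "t \<in> F" for t
    using that by (simp add: F_def)
  have labl: "?lab x = ?lab y" if "t \<in> F" "x \<in> t" "y \<in> t" "l t x = l t y" for t x y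
    using Fcases[OF that(1)]
  proof (elim disjE)
    assume t: "t \<in> F1"
    then have "lab1 x = lab1 y"
      using lab1[rule_format, OF t that(2,3)] that(4) l(1)[OF t] by simp
    moreover have "x \<in> V1" "y \<in> V1" using sub1(1)[OF t] that(2,3) by blast+
    ultimately show ?thesis by simp
  next
    assume t: "t \<in> F2"
    then have "lab2 x = lab2 y"
      using lab2[rule_format, OF t that(2,3)] that(4) l(2)[OF t] by simp
    moreover have "x \<notin> V1" "y \<notin> V1" using sub2(1)[OF t] that(2,3) disj by blast+
    ultimately show ?thesis by simp
  next
    assume "t = ?V"
    then show ?thesis using that(4) l(3) by simp
  qed
  have lam: "laminar ?V F"
  proof (rule laminarI)
    fix s t assume "s \<in> F" "t \<in> F"
    from Fcases[OF this(1)] Fcases[OF this(2)]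
    show "s \<subseteq> t \<or> t \<subseteq> s \<or> s \<inter> t = {}"
    proof (elim disjE)
      assume st: "s \<in> F1" "t \<in> F2"
      then show ?thesis using sub1(1)[OF st(1)] sub2(1)[OF st(2)] disj by blast
    next
      assume st: "s \<in> F2" "t \<in> F1"
      then show ?thesis using sub1(1)[OF st(2)] sub2(1)[OF st(1)] disj by blast
    next
      assume st: "s \<in> F1" "t \<in> F1"
      then show ?thesis using laminarD(4)[OF F1(1)] by simp
    next
      assume st: "s \<in> F2" "t \<in> F2"
      then show ?thesis using laminarD(4)[OF F2(1)] by simp
    qed (use sub1(1) sub2(1) in blast)+
  qed (use fin ne sub1(1,2) sub2(1,2) Fcases in blast)+
  have mono: "l t x = l t y"
    if st: "s \<in> F" "t \<in> F" and xy: "x \<in> s" "y \<in> s" and le: "s \<subseteq> t" and eq: "l s x = l s y"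
    for s t x y
    using Fcases[OF st(2)]
  proof (elim disjE)
    assume "t = ?V"
    then show ?thesis using labl[OF st(1) xy eq] l(3) by simp
  next
    assume t: "t \<in> F1"
    then have "s \<in> F1"
      using Fcases[OF st(1)] sub1[OF t] sub2(1)[of s] le xy(1) disj ne by blast
    then show ?thesis
      using mono1[rule_format, OF _ t xy le] eq l(1)[OF t] l(1)[of s] by simp
  next
    assume t: "t \<in> F2"
    then have "s \<in> F2"
      using Fcases[OF st(1)] sub2[OF t] sub1(1)[of s] le xy(1) disj ne by blast
    then show ?thesis
      using mono2[rule_format, OF _ t xy le] eq l(2)[OF t] l(2)[of s] by simp
  qed
  have rep: "represents F l R (E1 \<union> E2) x y" if xy: "x \<in> ?V" "y \<in> ?V" "x \<noteq> y" for x y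
  proof -
    consider "x \<in> V1" "y \<in> V1" | "x \<in> V2" "y \<in> V2"
      | "x \<in> V1" "y \<in> V2" | "x \<in> V2" "y \<in> V1" using xy by blast
    then show ?thesis
    proof cases
      case 1
      have "meet F x y = meet F1 x y"
        using 1 F1(2) sub2(1) disj unfolding meet_def F_def by blast
      moreover have "meet F1 x y \<in> F1" using meet_mem[OF F1] 1 by blast
      moreover have "(x, y) \<in> E1 \<union> E2 \<longleftrightarrow> (x, y) \<in> E1" using 1 arcs disj by blast
      ultimately show ?thesis
        using rep1 1 xy(3) l(1) R(1) by (simp add: represents_def Let_def)
    next
      case 2
      have "meet F x y = meet F2 x y"
        using 2 F2(2) sub1(1) disj unfolding meet_def F_def by blast
      moreover have "meet F2 x y \<in> F2" using meet_mem[OF F2] 2 by blast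
      moreover have "(x, y) \<in> E1 \<union> E2 \<longleftrightarrow> (x, y) \<in> E2" using 2 arcs disj by blast
      ultimately show ?thesis
        using rep2 2 xy(3) l(2) R(2) by (simp add: represents_def Let_def)
    next
      case 3
      then have "{t \<in> F. x \<in> t \<and> y \<in> t} = {?V}"
        using sub1(1) sub2(1) disj unfolding F_def by blast
      moreover have "(x, y) \<notin> E1 \<union> E2" using 3 arcs disj by blast
      ultimately show ?thesis using R(3) by (simp add: represents_def Let_def meet_def)
    next
      case 4
      then have "{t \<in> F. x \<in> t \<and> y \<in> t} = {?V}"
        using sub1(1) sub2(1) disj unfolding F_def by blast
      moreover have "(x, y) \<notin> E1 \<union> E2" using 4 arcs disj by blast
      ultimately show ?thesis using R(3) by (simp add: represents_def Let_def meet_def)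
    qed
  qed
  have le: "l t x \<le> w" if "t \<in> F" "x \<in> t" for t x
    using Fcases[OF that(1)]
  proof (elim disjE)
    assume "t = ?V"
    then show ?thesis using labV that(2) l(3) by simp
  qed (use le1 le2 l that(2) in simp_all)
  have VF': "?V \<in> F" by (simp add: F_def)
  show ?case
    using lam VF' le mono labl rep
    by (intro exI[of _ F] exI[of _ l] exI[of _ R] conjI ballI impI) assumption+
next
  case (add_arcs V E lab i j)
  from add_arcs.IH obtain F l R where F: "laminar V F" "V \<in> F"
    and rest: "\<forall>t\<in>F. \<forall>x\<in>t. l t x \<le> w"
      "\<forall>s\<in>F. \<forall>t\<in>F. \<forall>x\<in>s. \<forall>y\<in>s. s \<subseteq> t \<longrightarrow> l s x = l s y \<longrightarrow> l t x = l t y"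
    and lab: "\<forall>t\<in>F. \<forall>x\<in>t. \<forall>y\<in>t. l t x = l t y \<longrightarrow> lab x = lab y"
    and rep: "\<forall>x\<in>V. \<forall>y\<in>V. x \<noteq> y \<longrightarrow> represents F l R E x y"
    by (elim exE conjE)
  define R' where "R' t = R t \<union> {(l t u, l t v) |u v. u \<in> t \<and> v \<in> t \<and> lab u = i \<and> lab v = j}" for t
  have "represents F l R' (E \<union> {(u, v). u \<in> V \<and> v \<in> V \<and> lab u = i \<and> lab v = j}) x y"
    if xy: "x \<in> V" "y \<in> V" "x \<noteq> y" for x y
  proof -
    let ?m = "meet F x y"
    have m: "?m \<in> F" "x \<in> ?m" "y \<in> ?m" using meet_mem[OF F xy(1,2)] by (auto simp: meet_def)
    have "lab x = i \<and> lab y = j \<longleftrightarrow>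
        (\<exists>u v. (l ?m x, l ?m y) = (l ?m u, l ?m v) \<and> u \<in> ?m \<and> v \<in> ?m \<and> lab u = i \<and> lab v = j)"
      (is "?A = ?B")
    proof
      assume ?A then show ?B using m by blast
    next
      assume ?B
      then obtain u v where "l ?m x = l ?m u" "l ?m y = l ?m v" "u \<in> ?m" "v \<in> ?m" "lab u = i" "lab v = j"
        by blast
      then show ?A using lab m by metis
    qed
    then show ?thesis
      using rep xy unfolding represents_def Let_def R'_def by simp
  qed
  then have "\<forall>x\<in>V. \<forall>y\<in>V. x \<noteq> y \<longrightarrow>
      represents F l R' (E \<union> {(u, v). u \<in> V \<and> v \<in> V \<and> lab u = i \<and> lab v = j}) x y"
    by (intro ballI impI)
  with F rest lab show ?case
    by (intro exI[of _ F] exI[of _ l] exI[of _ R'] conjI) assumption+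
next
  case (relabel V E lab i j)
  from relabel.IH obtain F l R where "laminar V F" "V \<in> F"
      "\<forall>t\<in>F. \<forall>x\<in>t. l t x \<le> w"
      "\<forall>s\<in>F. \<forall>t\<in>F. \<forall>x\<in>s. \<forall>y\<in>s. s \<subseteq> t \<longrightarrow> l s x = l s y \<longrightarrow> l t x = l t y"
    and lab: "\<forall>t\<in>F. \<forall>x\<in>t. \<forall>y\<in>t. l t x = l t y \<longrightarrow> lab x = lab y"
    and "\<forall>x\<in>V. \<forall>y\<in>V. x \<noteq> y \<longrightarrow> represents F l R E x y"
    by (elim exE conjE)
  moreover have "\<forall>t\<in>F. \<forall>x\<in>t. \<forall>y\<in>t. l t x = l t y \<longrightarrow>
      (if lab x = i then j else lab x) = (if lab y = i then j else lab y)"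
    using lab by (intro ballI impI) metis
  ultimately show ?case
    by (intro exI[of _ F] exI[of _ l] exI[of _ R] conjI) assumption+
qed

lemma cw_construction_mono:
  "cw_construction w V E lab \<Longrightarrow> w \<le> w' \<Longrightarrow> cw_construction w' V E lab"
proof (induction rule: cw_construction.induct)
  case (single lab v)
  then show ?case by (intro cw_construction.single) auto
next
  case disjoint_union
  then show ?case by (intro cw_construction.disjoint_union) auto
next
  case (add_arcs V E lab i j)
  then show ?case by (intro cw_construction.add_arcs) auto
next
  case (relabel V E lab i j)
  then show ?case by (intro cw_construction.relabel) auto
qed

lemma cw_construction_no_arcs:
  assumes "finite V" "V \<noteq> {}" "\<forall>v\<in>V. lab v \<in> {1..w}"
  shows "cw_construction w V {} lab"
  using assms
proof (induction V rule: finite_ne_induct)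
  case (singleton v)
  then show ?case by (intro cw_construction.single) auto
next
  case (insert v V)
  have "cw_construction w {v} {} lab" using insert.prems by (intro cw_construction.single) auto
  from cw_construction.disjoint_union[OF this insert.IH] insert.hyps insert.prems
  show ?case by simp
qed

text \<open>
  With pairwise distinct labels the arcs can be added one at a time. This guarantees that the
  minimum defining the cliquewidth is attained.
\<close>

lemma ex_cw_construction:
  assumes "finite V" "V \<noteq> {}" "E \<subseteq> V \<times> V - Id"
  shows "\<exists>w lab. cw_construction w V E lab"
proof -
  obtain f :: "'a \<Rightarrow> nat" and n where f: "inj_on f V" "f ` V = {i. i < n}"
    using finite_imp_inj_to_nat_seg[OF assms(1)] by auto
  define lab where "lab v = Suc (f v)" for v
  have lab: "lab v \<in> {1..n}" if "v \<in> V" for v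
    using imageI[OF that, of f] f(2) by (simp add: lab_def Suc_le_eq)
  have "finite E" using assms by (meson finite_Diff finite_SigmaI finite_subset)
  then have "cw_construction n V E lab" using assms(3)
  proof (induction E rule: finite_induct)
    case empty
    then show ?case using cw_construction_no_arcs[OF assms(1,2)] lab by blast
  next
    case (insert e E)
    obtain x y where e: "e = (x, y)" by (cases e)
    have xy: "x \<in> V" "y \<in> V" "x \<noteq> y" using insert.prems e by auto
    have "lab u = lab v \<longleftrightarrow> u = v" if "u \<in> V" "v \<in> V" for u v
      using f(1) that by (auto simp: lab_def inj_on_def)
    then have "{(u, v). u \<in> V \<and> v \<in> V \<and> lab u = lab x \<and> lab v = lab y} = {(x, y)}"
      and "lab x \<noteq> lab y"
      using xy by auto
    then show ?case
      using cw_construction.add_arcs[of n V E lab "lab x" "lab y"] insert lab xy e by simp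
  qed
  then show ?thesis by blast
qed

lemma decodable_represented_arcs:
  "decodable {(j, R, E). coherent w k j \<and> tracked j = points j \<and> points j \<in> family j \<and>
      (\<forall>x\<in>points j. \<forall>y\<in>points j. x \<noteq> y \<longrightarrow> represents (family j) (label j) R E x y)}
    (\<lambda>(j, R, E). points j) (\<lambda>(j, R, E). points j \<times> points j - Id) (\<lambda>(j, R, E) x y. (x, y) \<in> E)"
  (is "decodable ?J ?X ?W ?Q")
proof -
  have J: "coherent w k j" "tracked j = points j" "points j \<in> family j"
    "x \<in> points j \<Longrightarrow> y \<in> points j \<Longrightarrow> x \<noteq> y \<Longrightarrow> represents (family j) (label j) R E x y"
    if "(j, R, E) \<in> ?J" for j R E x y
    using that by auto
  have pairs: "?W a \<subseteq> covered_pairs (fst a)" if "a \<in> ?J" for a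
    using that by (auto simp: covered_pairs_def)
  have label: "decodable ?J ?X ?W (\<lambda>a. label_at_meet (fst a))"
  proof (rule decodable_mono[OF decodable_label_at_meet[of w k], where g = fst])
    fix a assume a: "a \<in> ?J"
    then show "fst a \<in> {j. coherent w k j}" "?X a = points (fst a)" by auto
    show "(x, y) \<in> covered_pairs (fst a)" if "(x, y) \<in> ?W a" for x y
      using pairs[OF a] that by blast
  qed simp
  have label': "decodable ?J ?X ?W (\<lambda>a x y. label_at_meet (fst a) y x)"
    by (rule decodable_subset[OF decodable_swap[OF label]]) auto
  have less: "label_at_meet (fst a) x y < w" if a: "a \<in> ?J" and xy: "(x, y) \<in> ?W a" for a x y
  proof -
    have "coherent w k (fst a)" using a by auto
    note c = coherentD[OF this]
    have "(x, y) \<in> covered_pairs (fst a)" using pairs[OF a] xy by blast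
    then show ?thesis
      using c(2)[OF meet_mem[OF c(1)] meet_left]
      by (auto simp: covered_pairs_def label_at_meet_def)
  qed
  have less': "label_at_meet (fst a) y x < w" if "a \<in> ?J" "(x, y) \<in> ?W a" for a x y
    by (rule less[OF that(1)]) (use that(2) in \<open>cases a; auto\<close>)
  show ?thesis
  proof (rule decodable_cases[where V = "{..<w}" and C = "\<lambda>a. label_at_meet (fst a)"])
    fix i
    let ?Wi = "\<lambda>a. {(x, y) \<in> ?W a. label_at_meet (fst a) x y = i}"
    show "decodable ?J ?X ?W (\<lambda>a x y. label_at_meet (fst a) x y = i)"
      by (rule decodable_map[OF label])
    show "decodable ?J ?X ?Wi ?Q"
    proof (rule decodable_cases[where V = "{..<w}" and C = "\<lambda>a x y. label_at_meet (fst a) y x"])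
      fix i'
      show "decodable ?J ?X ?Wi (\<lambda>a x y. label_at_meet (fst a) y x = i')"
        by (rule decodable_subset[OF decodable_map[OF label']]) auto
      have "decodable ?J ?X ?W (\<lambda>a x y. (\<lambda>(j, R, E) m. (i, i') \<in> R m) a (meet (family (fst a)) x y))"
        by (rule decodable_meet_predicate) (use coherentD(1) in auto)
      then show "decodable ?J ?X (\<lambda>a. {(x, y) \<in> ?Wi a. label_at_meet (fst a) y x = i'}) ?Q"
      proof (rule decodable_subset)
        fix a x y assume a: "a \<in> ?J"
          and "(x, y) \<in> {(x, y) \<in> ?Wi a. label_at_meet (fst a) y x = i'}"
        then have xy: "(x, y) \<in> ?W a" and lab: "label_at_meet (fst a) x y = i"
          "label_at_meet (fst a) y x = i'" by auto
        obtain j R E where jRE: "a = (j, R, E)" by (cases a)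
        have "represents (family j) (label j) R E x y"
          using J(4)[of j R E x y] a xy by (simp add: jRE)
        then show "?Q a x y = (\<lambda>(j, R, E) m. (i, i') \<in> R m) a (meet (family (fst a)) x y)"
          using lab by (simp add: jRE represents_def Let_def label_at_meet_def meet_commute[of _ y])
      qed auto
      show "label_at_meet (fst a) y x \<in> {..<w}" if "a \<in> ?J" "(x, y) \<in> ?Wi a" for a x y
        using less'[OF that(1), of x y] that(2) by simp
    qed simp
    show "label_at_meet (fst a) x y \<in> {..<w}" if "a \<in> ?J" "(x, y) \<in> ?W a" for a x y
      using less[OF that] by simp
  qed simp
qed

section \<open>Boolean dimension is bounded in terms of cliquewidth\<close>

theorem theorem4:
  fixes w :: nat
  assumes "w \<ge> 1"
  shows "\<exists>b::nat. \<forall>(X :: 'a set) (r :: 'a rel).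
           finite X \<longrightarrow> partial_order_on X r \<longrightarrow> poset_cliquewidth X r \<le> w \<longrightarrow>
           boolean_dimension X r \<le> b"
proof -
  obtain b L dec where dec: "decodes {(j :: 'a labelling, R, E). coherent (Suc w) (Suc w) j \<and>
      tracked j = points j \<and> points j \<in> family j \<and>
      (\<forall>x\<in>points j. \<forall>y\<in>points j. x \<noteq> y \<longrightarrow> represents (family j) (label j) R E x y)}
    (\<lambda>(j, R, E). points j) (\<lambda>(j, R, E). points j \<times> points j - Id) (\<lambda>(j, R, E) x y. (x, y) \<in> E)
    b L dec" (is "decodes ?J _ _ _ _ _ _")
    by (rule decodableE[OF decodable_represented_arcs])
  have "boolean_dimension X r \<le> b"
    if X: "finite X" and r: "partial_order_on X r" and cw: "poset_cliquewidth X r \<le> w"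
    for X :: "'a set" and r :: "'a rel"
  proof (cases "X = {}")
    case True
    then have "boolean_realizer X r 0 L' d" for L' d by (simp add: boolean_realizer_def)
    then have "boolean_dimension X r \<le> 0"
      unfolding boolean_dimension_def by (intro Least_le) blast
    then show ?thesis by simp
  next
    case False
    define E where "E = {(x, y). (x, y) \<in> r \<and> x \<noteq> y}"
    have E: "E \<subseteq> X \<times> X - Id" using r by (auto simp: E_def order_on_defs)
    have "\<exists>lab. cw_construction (cliquewidth X E) X E lab"
      using LeastI_ex[OF ex_cw_construction[OF X False E]] False by (simp add: cliquewidth_def)
    then obtain lab where "cw_construction w X E lab"
      using cw cw_construction_mono unfolding poset_cliquewidth_def E_def by blast
    from cw_construction_representation[OF this] obtain F l R where F: "laminar X F" "X \<in> F"
      and le: "\<forall>t\<in>F. \<forall>x\<in>t. l t x \<le> w"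
      and mono: "\<forall>s\<in>F. \<forall>t\<in>F. \<forall>x\<in>s. \<forall>y\<in>s. s \<subseteq> t \<longrightarrow> l s x = l s y \<longrightarrow> l t x = l t y"
      and rep: "\<forall>x\<in>X. \<forall>y\<in>X. x \<noteq> y \<longrightarrow> represents F l R E x y"
      by (elim exE conjE)
    define j where "j = \<lparr>points = X, family = F, tracked = X, label = l\<rparr>"
    have sel [simp]: "points j = X" "family j = F" "tracked j = X" "label j = l"
      by (simp_all add: j_def)
    have card: "card (l t ` (t \<inter> X)) \<le> Suc w" if "t \<in> F" for t
    proof -
      have "l t ` (t \<inter> X) \<subseteq> {..w}" using le that by auto
      from card_mono[OF _ this] show ?thesis by simp
    qed
    \<comment> \<open>Labels lie in \<open>{0..w}\<close>, so \<open>Suc w\<close> is both a strict bound and a bound on their number.\<close>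
    have "coherent (Suc w) (Suc w) j"
      unfolding coherent_def sel
    proof (intro conjI ballI impI)
      fix s t x y assume "s \<in> F" "t \<in> F" "s \<subseteq> t" "x \<in> s \<inter> X" "y \<in> s \<inter> X" "l s x = l s y"
      then show "l t x = l t y" using mono[rule_format, of s t x y] by blast
    next
      fix t x assume "t \<in> F" "x \<in> t \<inter> X"
      then show "l t x < Suc w" using le[rule_format, of t x] by simp
    qed (fact F(1) card)+
    then have J: "(j, R, E) \<in> ?J" using F(2) rep by simp
    from bspec[OF conjunct1[OF dec[unfolded decodes_def]] J]
    have L: "\<forall>i<b. linear_order_on X (L (j, R, E) i)" by simp
    from bspec[OF conjunct2[OF dec[unfolded decodes_def]] J]
    have bits: "\<forall>x y. (x, y) \<in> X \<times> X - Id \<longrightarrow> (x, y) \<in> E = dec (order_bits b (L (j, R, E)) x y)"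
      unfolding prod.case sel .
    have "boolean_realizer X r b (L (j, R, E)) dec"
      unfolding boolean_realizer_def
    proof (intro conjI allI ballI impI)
      show "linear_order_on X (L (j, R, E) i)" if "i < b" for i
        using L that by simp
      fix x y assume "x \<in> X" "y \<in> X" "x \<noteq> y"
      then have "(x, y) \<in> E \<longleftrightarrow> dec (order_bits b (L (j, R, E)) x y)"
        using bits by blast
      then show "(x, y) \<in> r \<longleftrightarrow> dec (map (\<lambda>i. (x, y) \<in> L (j, R, E) i) [0..<b])"
        using \<open>x \<noteq> y\<close> by (simp add: E_def order_bits_def)
    qed
    then show ?thesis
      unfolding boolean_dimension_def by (intro Least_le) blast
  qed
  then show ?thesis by blast
qed

end
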